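(* Let $(E,\mathcal L,\mathcal B)$ be a normal labelled space and $K$ a field. Then $L_K(E,\mathcal L,\mathcal B)$ is semiprimitive.
   Context: Graphs and labels. A directed graph $E=(E^0,E^1,r,s)$ has a nonempty vertex set $E^0$, an edge set $E^1$, and range and source maps $r,s:E^1\to E^0$. A path of length $n\ge1$ is a sequence $\lambda=\lambda_1\cdots\lambda_n$ of edges with $r(\lambda_i)=s(\lambda_{i+1})$; its source is $s(\lambda_1)$ and its range is $r(\lambda_n)$; $E^n$ is the set of paths of length $n$. A labelled graph $(E,\mathcal L)$ is a directed graph with a surjective map $\mathcal L:E^1\to\mathcal A$ onto a nonempty set $\mathcal A$ (the alphabet), extended to paths by $\mathcal L(\lambda_1\cdots\lambda_n)=\mathcal L(\lambda_1)\cdots\mathcal L(\lambda_n)$. Put $\mathcal L^n=\mathcal L(E^n)$ for $n\geq 1$, $\mathcal L^{\ge1}=\bigcup_{n\ge1}\mathcal L^n$ and $\mathcal L^*=\mathcal L^{\ge1}\cup\{\omega\}$, with $\omega$ the empty word. For $A\subseteq E^0$ and $\alpha\in\mathcal L^{\ge1}$, $r(A,\alpha)=\{r(\lambda)\mid \lambda \text{ a path},\ \mathcal L(\lambda)=\alpha,\ s(\lambda)\in A\}$; $r(A,\omega)=A$; $r(\alpha)=r(E^0,\alpha)$; $\mathcal L(AE^1)=\{\mathcal L(e)\mid e\in E^1,\ s(e)\in A\}$. Labelled spaces. A labelled space $(E,\mathcal L,\mathcal B)$ is a labelled graph with a family $\mathcal B$ of subsets of $E^0$ closed under finite intersections and finite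 unions, containing $r(\alpha)$ for all $\alpha\in\mathcal L^{\ge1}$, and such that $r(A,\alpha)\in\mathcal B$ for all $A\in\mathcal B$, $\alpha\in\mathcal L^*$. It is normal if it is weakly left-resolving, i.e. $r(A\cap B,\alpha)=r(A,\alpha)\cap r(B,\alpha)$ for all $A,B\in\mathcal B$, $\alpha\in\mathcal L^{\ge1}$, and $\mathcal B$ is closed under relative complements. A nonempty $A\in\mathcal B$ is regular if $0<|\mathcal L(BE^1)|<\infty$ for every nonempty $B\in\mathcal B$ with $B\subseteq A$; $\mathcal B_{\mathrm{reg}}$ is the set of regular elements together with $\emptyset$. The algebra. $L_K(E,\mathcal L,\mathcal B)$ (Leavitt labelled path algebra) is the universal (associative, not necessarily unital) $K$-algebra with generators $\{p_A\mid A\in\mathcal B\}$ and $\{s_a,s_a^*\mid a\in\mathcal A\}$ and relations: (i) $p_{A\cap B}=p_Ap_B$, $p_{A\cup B}=p_A+p_B-p_{A\cap B}$, $p_\emptyset=0$ for $A,B\in\mathcal B$; (ii) $p_As_a=s_ap_{r(A,a)}$ and $s_a^*p_A=p_{r(A,a)}s_a^*$ for $A\in\mathcal B$, $a\in\mathcal A$; (iii) $s_a^*s_a=p_{r(a)}$, and $s_b^*s_a=0$ if $b\ne a$; (iv) $s_as_a^*s_a=s_a$ and $s_a^*s_as_a^*=s_a^*$; (v) $p_A=\sum_{a\in\mathcal L(AE^1)}s_ap_{r(A,a)}s_a^*$ for every $A\in\mathcal B_{\mathrm{reg}}$. A (not necessarily unital) ring $R$ is semiprimitive if its Jacobson radical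 $J(R)$ is zero. Here $x\in R$ is right quasi-regular if there is $y\in R$ with $x+y-xy=0$, and left quasi-regular if there is $z\in R$ with $x+z-zx=0$; an ideal is quasi-regular if all its elements are both left and right quasi-regular; $J(R)$ is the largest quasi-regular ideal of $R$. *)

theory Defs
  imports
    "Graph_Theory.Arc_Walk"
    "HOL-Library.Poly_Mapping"
    "HOL-Algebra.Module"
    "HOL-Algebra.QuotRing"
begin

section \<open>Labelled spaces\<close>

text \<open>
  A directed graph is a \<^locale>\<open>wf_digraph\<close>, with source map \<^const>\<open>tail\<close> and range map
  \<^const>\<open>head\<close>; infinite vertex and arc sets are allowed.  The paths of length at least one
  with source \<open>u\<close> and range \<open>v\<close> are the nonempty \<open>p\<close> with \<open>awalk u p v\<close>.  Words over the
  alphabet are lists, and the empty word \<open>\<omega>\<close> is \<open>[]\<close>.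
\<close>

definition rel_range :: "('v, 'e) pre_digraph \<Rightarrow> ('e \<Rightarrow> 'l) \<Rightarrow> 'v set \<Rightarrow> 'l list \<Rightarrow> 'v set" where
  "rel_range E lab A \<alpha> =
     (if \<alpha> = [] then A
      else {v. \<exists>u p. u \<in> A \<and> p \<noteq> [] \<and> pre_digraph.awalk E u p v \<and> map lab p = \<alpha>})"

definition labelled_paths1 :: "('v, 'e) pre_digraph \<Rightarrow> ('e \<Rightarrow> 'l) \<Rightarrow> 'l list set" where
  "labelled_paths1 E lab = {map lab p | u p v. p \<noteq> [] \<and> pre_digraph.awalk E u p v}"

definition labelled_paths :: "('v, 'e) pre_digraph \<Rightarrow> ('e \<Rightarrow> 'l) \<Rightarrow> 'l list set" where
  "labelled_paths E lab = insert [] (labelled_paths1 E lab)"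

definition out_labels :: "('v, 'e) pre_digraph \<Rightarrow> ('e \<Rightarrow> 'l) \<Rightarrow> 'v set \<Rightarrow> 'l set" where
  "out_labels E lab A = {lab e | e. e \<in> arcs E \<and> tail E e \<in> A}"

locale labelled_graph = wf_digraph E for E :: "('v, 'e) pre_digraph" +
  fixes lab :: "'e \<Rightarrow> 'l" and alphabet :: "'l set"
  assumes verts_nonempty: "verts E \<noteq> {}"
    and alphabet_nonempty: "alphabet \<noteq> {}"
    and lab_surj: "lab ` arcs E = alphabet"

locale labelled_space = labelled_graph E lab alphabet
  for E :: "('v, 'e) pre_digraph" and lab :: "'e \<Rightarrow> 'l" and alphabet :: "'l set" +
  fixes \<B> :: "'v set set"
  assumes subset_verts: "A \<in> \<B> \<Longrightarrow> A \<subseteq> verts E"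
    and Int_closed: "A \<in> \<B> \<Longrightarrow> B \<in> \<B> \<Longrightarrow> A \<inter> B \<in> \<B>"
    and Un_closed: "A \<in> \<B> \<Longrightarrow> B \<in> \<B> \<Longrightarrow> A \<union> B \<in> \<B>"
    and range_closed: "\<alpha> \<in> labelled_paths1 E lab \<Longrightarrow> rel_range E lab (verts E) \<alpha> \<in> \<B>"
    and rel_range_closed:
      "A \<in> \<B> \<Longrightarrow> \<alpha> \<in> labelled_paths E lab \<Longrightarrow> rel_range E lab A \<alpha> \<in> \<B>"

locale normal_labelled_space = labelled_space E lab alphabet \<B>
  for E :: "('v, 'e) pre_digraph" and lab :: "'e \<Rightarrow> 'l" and alphabet :: "'l set"
    and \<B> :: "'v set set" +
  assumes weakly_left_resolving:
      "A \<in> \<B> \<Longrightarrow> B \<in> \<B> \<Longrightarrow> \<alpha> \<in> labelled_paths1 E lab \<Longrightarrow>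
       rel_range E lab (A \<inter> B) \<alpha> = rel_range E lab A \<alpha> \<inter> rel_range E lab B \<alpha>"
    and Diff_closed: "A \<in> \<B> \<Longrightarrow> B \<in> \<B> \<Longrightarrow> A - B \<in> \<B>"

definition regular_sets ::
    "('v, 'e) pre_digraph \<Rightarrow> ('e \<Rightarrow> 'l) \<Rightarrow> 'v set set \<Rightarrow> 'v set set" where
  "regular_sets E lab \<B> =
     insert {} {A \<in> \<B>. A \<noteq> {} \<and>
       (\<forall>B\<in>\<B>. B \<noteq> {} \<and> B \<subseteq> A \<longrightarrow> out_labels E lab B \<noteq> {} \<and> finite (out_labels E lab B))}"


section \<open>Non-unital rings and the Jacobson radical\<close>

text \<open>
  The rings of \<^theory>\<open>HOL-Algebra.Ring\<close> are unital.  For non-unital rings its records are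
  reused, but the field \<^const>\<open>one\<close> carries no meaning and no notion below refers to it.
\<close>

locale nonunital_ring = abelian_group R for R (structure) +
  assumes m_closed: "x \<in> carrier R \<Longrightarrow> y \<in> carrier R \<Longrightarrow> x \<otimes> y \<in> carrier R"
    and m_assoc: "x \<in> carrier R \<Longrightarrow> y \<in> carrier R \<Longrightarrow> z \<in> carrier R \<Longrightarrow>
      (x \<otimes> y) \<otimes> z = x \<otimes> (y \<otimes> z)"
    and l_distr: "x \<in> carrier R \<Longrightarrow> y \<in> carrier R \<Longrightarrow> z \<in> carrier R \<Longrightarrow>
      (x \<oplus> y) \<otimes> z = x \<otimes> z \<oplus> y \<otimes> z"
    and r_distr: "x \<in> carrier R \<Longrightarrow> y \<in> carrier R \<Longrightarrow> z \<in> carrier R \<Longrightarrow>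
      z \<otimes> (x \<oplus> y) = z \<otimes> x \<oplus> z \<otimes> y"

locale nonunital_ideal = additive_subgroup I R + nonunital_ring R for I and R (structure) +
  assumes I_l_closed: "a \<in> I \<Longrightarrow> x \<in> carrier R \<Longrightarrow> x \<otimes> a \<in> I"
    and I_r_closed: "a \<in> I \<Longrightarrow> x \<in> carrier R \<Longrightarrow> a \<otimes> x \<in> I"

definition right_quasi_regular :: "('a, 'm) ring_scheme \<Rightarrow> 'a \<Rightarrow> bool" where
  "right_quasi_regular R x \<longleftrightarrow>
     (\<exists>y\<in>carrier R. (x \<oplus>\<^bsub>R\<^esub> y) \<ominus>\<^bsub>R\<^esub> (x \<otimes>\<^bsub>R\<^esub> y) = \<zero>\<^bsub>R\<^esub>)"

definition left_quasi_regular :: "('a, 'm) ring_scheme \<Rightarrow> 'a \<Rightarrow> bool" where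
  "left_quasi_regular R x \<longleftrightarrow>
     (\<exists>z\<in>carrier R. (x \<oplus>\<^bsub>R\<^esub> z) \<ominus>\<^bsub>R\<^esub> (z \<otimes>\<^bsub>R\<^esub> x) = \<zero>\<^bsub>R\<^esub>)"

definition quasi_regular_ideal :: "('a, 'm) ring_scheme \<Rightarrow> 'a set \<Rightarrow> bool" where
  "quasi_regular_ideal R I \<longleftrightarrow>
     nonunital_ideal I R \<and> (\<forall>x\<in>I. right_quasi_regular R x \<and> left_quasi_regular R x)"

text \<open>On sets, \<^const>\<open>Greatest\<close> is the largest element with respect to inclusion.\<close>

definition jacobson_radical :: "('a, 'm) ring_scheme \<Rightarrow> 'a set" where
  "jacobson_radical R = (GREATEST I. quasi_regular_ideal R I)"

definition semiprimitive :: "('a, 'm) ring_scheme \<Rightarrow> bool" where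
  "semiprimitive R \<longleftrightarrow> jacobson_radical R = {\<zero>\<^bsub>R\<^esub>}"


section \<open>Algebras given by generators and relations\<close>

text \<open>Lists form the free monoid, so that \<open>'g list \<Rightarrow>\<^sub>0 'k\<close> is the free unital algebra on \<open>'g\<close>.\<close>

instantiation list :: (type) monoid_add
begin
definition zero_list_def: "0 = []"
definition plus_list_def: "xs + ys = xs @ ys"
instance by standard (simp_all add: zero_list_def plus_list_def)
end

text \<open>
  The free non-unital algebra on \<open>X\<close>: the combinations of nonempty words over \<open>X\<close>.
\<close>

definition free_algebra :: "'g set \<Rightarrow> ('k::field, 'g list \<Rightarrow>\<^sub>0 'k) module" where
  "free_algebra X =
     \<lparr>carrier = {f. Poly_Mapping.keys f \<subseteq> lists X - {[]}},
      mult = (*), one = 0, zero = 0, add = (+),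
      smult = (\<lambda>c. Poly_Mapping.map ((*) c))\<rparr>"

definition algebra_ideal :: "('k, 'a, 'm) module_scheme \<Rightarrow> 'a set \<Rightarrow> bool" where
  "algebra_ideal F I \<longleftrightarrow> nonunital_ideal I F \<and> (\<forall>c. \<forall>x\<in>I. c \<odot>\<^bsub>F\<^esub> x \<in> I)"

definition quotient_algebra :: "('k, 'a, 'm) module_scheme \<Rightarrow> 'a set \<Rightarrow> ('k, 'a set) module" where
  "quotient_algebra F I =
     ring.extend (F Quot I) \<lparr>smult = (\<lambda>c X. \<Union>x\<in>X. I +>\<^bsub>F\<^esub> (c \<odot>\<^bsub>F\<^esub> x))\<rparr>"

text \<open>
  The universal algebra with generators \<open>X\<close> subject to \<open>r = 0\<close> for \<open>r \<in> Rel\<close>; the \<open>hull\<close> is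
  the smallest algebra ideal containing \<open>Rel\<close>.
\<close>

definition presented_algebra ::
    "'g set \<Rightarrow> ('g list \<Rightarrow>\<^sub>0 'k) set \<Rightarrow> ('k::field, ('g list \<Rightarrow>\<^sub>0 'k) set) module" where
  "presented_algebra X Rel =
     quotient_algebra (free_algebra X) (algebra_ideal (free_algebra X) hull Rel)"


section \<open>The Leavitt labelled path algebra\<close>

datatype ('v, 'l) generator = Gen_p "'v set" | Gen_s 'l | Gen_s_star 'l

abbreviation p_elem :: "'v set \<Rightarrow> (('v, 'l) generator list \<Rightarrow>\<^sub>0 'k::field)" where
  "p_elem A \<equiv> Poly_Mapping.single [Gen_p A] 1"

abbreviation s_elem :: "'l \<Rightarrow> (('v, 'l) generator list \<Rightarrow>\<^sub>0 'k::field)" where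
  "s_elem a \<equiv> Poly_Mapping.single [Gen_s a] 1"

abbreviation s_star_elem :: "'l \<Rightarrow> (('v, 'l) generator list \<Rightarrow>\<^sub>0 'k::field)" where
  "s_star_elem a \<equiv> Poly_Mapping.single [Gen_s_star a] 1"

definition leavitt_generators :: "'l set \<Rightarrow> 'v set set \<Rightarrow> ('v, 'l) generator set" where
  "leavitt_generators alphabet \<B> = Gen_p ` \<B> \<union> Gen_s ` alphabet \<union> Gen_s_star ` alphabet"

text \<open>A relation \<open>x = y\<close> is represented by \<open>x - y\<close>.\<close>

inductive_set leavitt_relations ::
    "('v, 'e) pre_digraph \<Rightarrow> ('e \<Rightarrow> 'l) \<Rightarrow> 'l set \<Rightarrow> 'v set set \<Rightarrow>
     (('v, 'l) generator list \<Rightarrow>\<^sub>0 'k::field) set"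
  for E :: "('v, 'e) pre_digraph" and lab :: "'e \<Rightarrow> 'l" and alphabet :: "'l set"
    and \<B> :: "'v set set"
where
  p_Int: "A \<in> \<B> \<Longrightarrow> B \<in> \<B> \<Longrightarrow>
    p_elem (A \<inter> B) - p_elem A * p_elem B \<in> leavitt_relations E lab alphabet \<B>"
| p_Un: "A \<in> \<B> \<Longrightarrow> B \<in> \<B> \<Longrightarrow>
    p_elem (A \<union> B) - (p_elem A + p_elem B - p_elem (A \<inter> B))
      \<in> leavitt_relations E lab alphabet \<B>"
| p_empty: "p_elem {} \<in> leavitt_relations E lab alphabet \<B>"
| p_s: "A \<in> \<B> \<Longrightarrow> a \<in> alphabet \<Longrightarrow>
    p_elem A * s_elem a - s_elem a * p_elem (rel_range E lab A [a])
      \<in> leavitt_relations E lab alphabet \<B>"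
| s_star_p: "A \<in> \<B> \<Longrightarrow> a \<in> alphabet \<Longrightarrow>
    s_star_elem a * p_elem A - p_elem (rel_range E lab A [a]) * s_star_elem a
      \<in> leavitt_relations E lab alphabet \<B>"
| s_star_s: "a \<in> alphabet \<Longrightarrow>
    s_star_elem a * s_elem a - p_elem (rel_range E lab (verts E) [a])
      \<in> leavitt_relations E lab alphabet \<B>"
| s_star_s_neq: "a \<in> alphabet \<Longrightarrow> b \<in> alphabet \<Longrightarrow> b \<noteq> a \<Longrightarrow>
    s_star_elem b * s_elem a \<in> leavitt_relations E lab alphabet \<B>"
| s_s_star_s: "a \<in> alphabet \<Longrightarrow>
    s_elem a * s_star_elem a * s_elem a - s_elem a \<in> leavitt_relations E lab alphabet \<B>"
| s_star_s_s_star: "a \<in> alphabet \<Longrightarrow>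
    s_star_elem a * s_elem a * s_star_elem a - s_star_elem a
      \<in> leavitt_relations E lab alphabet \<B>"
| p_regular: "A \<in> regular_sets E lab \<B> \<Longrightarrow>
    p_elem A
      - (\<Sum>a\<in>out_labels E lab A. s_elem a * p_elem (rel_range E lab A [a]) * s_star_elem a)
      \<in> leavitt_relations E lab alphabet \<B>"

text \<open>The argument of type \<^typ>\<open>'k itself\<close> names the base field.\<close>

definition leavitt_labelled_path_algebra ::
    "'k itself \<Rightarrow> ('v, 'e) pre_digraph \<Rightarrow> ('e \<Rightarrow> 'l) \<Rightarrow> 'l set \<Rightarrow> 'v set set \<Rightarrow>
     ('k::field, (('v, 'l) generator list \<Rightarrow>\<^sub>0 'k) set) module" where
  "leavitt_labelled_path_algebra (_ :: 'k itself) E lab alphabet \<B> =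
     presented_algebra (leavitt_generators alphabet \<B>)
       (leavitt_relations E lab alphabet \<B> :: (('v, 'l) generator list \<Rightarrow>\<^sub>0 'k) set)"


section \<open>Well-definedness\<close>

text \<open>
  For a normal labelled space, the relations lie in the free non-unital algebra on the generators
  (in particular the empty set is in \<open>\<B>\<close>), they generate an ideal in the sense of
  \<^const>\<open>algebra_ideal\<close>, and the quotient is a non-unital ring.
\<close>

lemma keys_mult_free:
  fixes f g :: "'g list \<Rightarrow>\<^sub>0 'k::field"
  assumes "Poly_Mapping.keys f \<subseteq> lists X - {[]}" "Poly_Mapping.keys g \<subseteq> lists X - {[]}"
  shows "Poly_Mapping.keys (f * g) \<subseteq> lists X - {[]}"
proof
  fix w assume "w \<in> Poly_Mapping.keys (f * g)"
  then obtain a b where "w = a + b" "a \<in> Poly_Mapping.keys f" "b \<in> Poly_Mapping.keys g"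
    using keys_mult[of f g] by blast
  with assms show "w \<in> lists X - {[]}" by (auto simp: plus_list_def)
qed

lemma nonunital_ring_free_algebra: "nonunital_ring (free_algebra X)"
proof -
  have "abelian_group (free_algebra X :: ('k::field, _) module)"
  proof (rule abelian_groupI)
    fix x y :: "'a list \<Rightarrow>\<^sub>0 'k"
    assume "x \<in> carrier (free_algebra X)" "y \<in> carrier (free_algebra X)"
    then show "x \<oplus>\<^bsub>free_algebra X\<^esub> y \<in> carrier (free_algebra X)"
      using Poly_Mapping.keys_add[of x y] by (auto simp: free_algebra_def)
  next
    fix x :: "'a list \<Rightarrow>\<^sub>0 'k"
    assume "x \<in> carrier (free_algebra X)"
    then show "\<exists>y\<in>carrier (free_algebra X). y \<oplus>\<^bsub>free_algebra X\<^esub> x = \<zero>\<^bsub>free_algebra X\<^esub>"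
      by (intro bexI[of _ "- x"]) (auto simp: free_algebra_def)
  qed (auto simp: free_algebra_def algebra_simps)
  then show ?thesis
    by (rule nonunital_ring.intro, unfold_locales)
      (auto simp: free_algebra_def algebra_simps dest: keys_mult_free[THEN subsetD, rotated -1])
qed

context nonunital_ideal begin

lemma abelian_subgroup: "abelian_subgroup I R"
  by (rule abelian_subgroupI3) (unfold_locales)

lemma abelian_subgroup_rcos_sum: 
  "x \<in> carrier R \<Longrightarrow> y \<in> carrier R \<Longrightarrow> (I +> x) <+> (I +> y) = I +> (x \<oplus> y)"
  by (rule abelian_subgroup.a_rcos_sum[OF abelian_subgroup])

lemma rcoset_mult: 
  assumes x: "x \<in> carrier R" and y: "y \<in> carrier R"
  shows "rcoset_mult R I (I +> x) (I +> y) = I +> (x \<otimes> y)"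
proof -
  have eq: "I +> (x' \<otimes> y') = I +> (x \<otimes> y)" if "x' \<in> I +> x" "y' \<in> I +> y" for x' y'
  proof -
    from that obtain i j where i: "i \<in> I" "x' = i \<oplus> x" and j: "j \<in> I" "y' = j \<oplus> y"
      by (auto simp: a_r_coset_def')
    have ic: "i \<in> carrier R" "j \<in> carrier R" using i j a_subset by auto
    have "x' \<otimes> y' = (i \<otimes> (j \<oplus> y) \<oplus> x \<otimes> j) \<oplus> x \<otimes> y"
      using x y ic by (simp add: i j l_distr r_distr m_closed a_ac)
    moreover have k: "i \<otimes> (j \<oplus> y) \<oplus> x \<otimes> j \<in> I"
      using x y ic i j by (simp add: I_l_closed I_r_closed)
    ultimately have "x' \<otimes> y' \<in> I +> (x \<otimes> y)"
      by (auto simp: a_r_coset_def')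
    then show ?thesis
      using abelian_subgroup.a_repr_independence'[OF abelian_subgroup] x y m_closed by metis
  qed
  have "x \<in> I +> x" "y \<in> I +> y"
    using abelian_subgroup.a_rcos_self[OF abelian_subgroup] x y by auto
  then show ?thesis unfolding rcoset_mult_def using eq by blast
qed

end

lemma nonunital_ring_quotient:
  assumes "algebra_ideal F I"
  shows "nonunital_ring (quotient_algebra F I)"
proof -
  interpret nonunital_ideal I F using assms by (simp add: algebra_ideal_def)
  have c: "carrier (quotient_algebra F I) = (\<lambda>x. I +>\<^bsub>F\<^esub> x) ` carrier F"
    by (auto simp: quotient_algebra_def ring.defs FactRing_def A_RCOSETS_def')
  have a: "add (quotient_algebra F I) = set_add F" "mult (quotient_algebra F I) = rcoset_mult F I"
     "zero (quotient_algebra F I) = I"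
    by (auto simp: quotient_algebra_def ring.defs FactRing_def)
  have z: "I = I +>\<^bsub>F\<^esub> \<zero>\<^bsub>F\<^esub>"  by (simp add: a_subset)
  note sums = abelian_subgroup_rcos_sum rcoset_mult m_closed
  have "abelian_group (quotient_algebra F I)"
  proof (rule abelian_groupI, goal_cases)
    case (1 x y) then show ?case by (auto simp: c a sums)
  next
    case 2 then show ?case using z by (auto simp: c a)
  next
    case (3 x y z) then show ?case by (auto simp: c a sums a_assoc)
  next
    case (4 x y) then show ?case by (auto simp: c a sums a_comm)
  next
    case (5 x) then obtain u where u: "u \<in> carrier F" "x = I +>\<^bsub>F\<^esub> u" by (auto simp: c)
    then show ?case using abelian_subgroup_rcos_sum[of "\<zero>\<^bsub>F\<^esub>" u] z by (simp add: a)
  next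
    case (6 x) then obtain u where u: "u \<in> carrier F" "x = I +>\<^bsub>F\<^esub> u" by (auto simp: c)
    then show ?case using abelian_subgroup_rcos_sum[of "\<ominus>\<^bsub>F\<^esub> u" u] z
      by (auto simp add: a c l_neg)
  qed
  then show ?thesis
    by (rule nonunital_ring.intro, unfold_locales)
      (auto simp: c a sums m_assoc l_distr r_distr)
qed

lemma algebra_ideal_carrier: "algebra_ideal (free_algebra X) (carrier (free_algebra X :: ('k::field,_) module))"
proof -
  interpret nonunital_ring "free_algebra X :: ('k,_) module" by (rule nonunital_ring_free_algebra)
  have "Poly_Mapping.keys (Poly_Mapping.map ((*) c) f) \<subseteq> Poly_Mapping.keys f" for c::'k and f :: "'a list \<Rightarrow>\<^sub>0 'k"
    by (auto simp: in_keys_iff map.rep_eq when_def)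
  then have "\<forall>c. \<forall>x\<in>carrier (free_algebra X). c \<odot>\<^bsub>free_algebra X\<^esub> x \<in> carrier (free_algebra X :: ('k,_) module)"
    by (fastforce simp: free_algebra_def)
  moreover have "nonunital_ideal (carrier (free_algebra X)) (free_algebra X :: ('k,_) module)"
    by unfold_locales (auto simp: m_closed  simp flip: a_inv_def)
  ultimately show ?thesis by (simp add: algebra_ideal_def)
qed

lemma algebra_ideal_hull:
  fixes Rel :: "('g list \<Rightarrow>\<^sub>0 'k::field) set"
  assumes "Rel \<subseteq> carrier (free_algebra X :: ('k, _) module)"
  shows "algebra_ideal (free_algebra X :: ('k, _) module)
    (algebra_ideal (free_algebra X :: ('k, _) module) hull Rel)" (is "algebra_ideal ?F ?H")
proof -
  interpret nonunital_ring ?F by (rule nonunital_ring_free_algebra)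
  let ?T = "{I. algebra_ideal ?F I \<and> Rel \<subseteq> I}"
  have C: "carrier ?F \<in> ?T" using assms algebra_ideal_carrier by auto
  have sub: "subgroup I (add_monoid ?F)" if "I \<in> ?T" for I
    using that by (simp add: algebra_ideal_def nonunital_ideal_def additive_subgroup_def)
  have "subgroup (\<Inter>?T) (add_monoid ?F)"
    using C sub by (intro add.subgroups_Inter) blast+
  then have "additive_subgroup ?H ?F"
    by (simp add: additive_subgroup_def hull_def)
  moreover have "nonunital_ideal_axioms ?H ?F"
    by (auto simp: nonunital_ideal_axioms_def hull_def algebra_ideal_def nonunital_ideal_def)
  ultimately show ?thesis
    by (auto simp: algebra_ideal_def nonunital_ideal_def nonunital_ring_axioms)
      (auto simp: hull_def algebra_ideal_def)
qed

context normal_labelled_space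
begin

lemma empty_in: "{} \<in> \<B>"
proof -
  obtain e where "e \<in> arcs E" using alphabet_nonempty lab_surj by blast
  then have "[lab e] \<in> labelled_paths1 E lab"
    unfolding labelled_paths1_def
    by (intro CollectI exI[of _ "[e]"] exI[of _ "tail E e"] exI[of _ "head E e"])
      (auto simp: awalk_def)
  then show ?thesis using Diff_closed[OF range_closed range_closed] by fastforce
qed

lemma letter_in: "a \<in> alphabet \<Longrightarrow> [a] \<in> labelled_paths1 E lab"
proof -
  assume "a \<in> alphabet"
  then obtain e where "e \<in> arcs E" "a = lab e" using lab_surj by blast
  then show ?thesis
    unfolding labelled_paths1_def
    by (intro CollectI exI[of _ "[e]"] exI[of _ "tail E e"] exI[of _ "head E e"])
      (auto simp: awalk_def)
qed

lemma leavitt_relations_subset: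
  "leavitt_relations E lab alphabet \<B>
    \<subseteq> carrier (free_algebra (leavitt_generators alphabet \<B>) :: ('k::field, _) module)"
proof
  let ?X = "leavitt_generators alphabet \<B> :: ('v, 'l) generator set"
  let ?W = "\<lambda>f::('v, 'l) generator list \<Rightarrow>\<^sub>0 'k. Poly_Mapping.keys f \<subseteq> lists ?X - {[]}"
  have d: "?W (f - g)" if "?W f" "?W g" for f g using that keys_diff[of f g] by blast
  have p: "?W (f + g)" if "?W f" "?W g" for f g using that Poly_Mapping.keys_add[of f g] by blast
  have m: "?W (f * g)" if "?W f" "?W g" for f g using that keys_mult_free by blast
  have su: "?W (sum h S)" if "\<And>a. a \<in> S \<Longrightarrow> ?W (h a)" for h and S :: "'l set"
    using that
  proof (induction S rule: infinite_finite_induct)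
    case (insert a S)
    have "?W (h a + sum h S)"
      by (rule p) (use insert in \<open>blast+\<close>)
    then show ?case using insert.hyps by simp
  qed auto
  have P: "?W (p_elem A)" if "A \<in> \<B>" for A
    using that by (auto simp: leavitt_generators_def)
  have S: "?W (s_elem a)" "?W (s_star_elem a)" if "a \<in> alphabet" for a
    using that by (auto simp: leavitt_generators_def)
  have R: "rel_range E lab A [a] \<in> \<B>" if "A \<in> \<B>" "a \<in> alphabet" for A a
    using that rel_range_closed letter_in by (auto simp: labelled_paths_def)
  have R': "rel_range E lab (verts E) [a] \<in> \<B>" if "a \<in> alphabet" for a
    using that range_closed letter_in by blast
  have rg: "A \<in> \<B>" if "A \<in> regular_sets E lab \<B>" for A
    using that empty_in by (auto simp: regular_sets_def)
  have ol: "a \<in> alphabet" if "a \<in> out_labels E lab A" for a A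
    using that lab_surj by (auto simp: out_labels_def)
  fix x :: "('v, 'l) generator list \<Rightarrow>\<^sub>0 'k" assume "x \<in> leavitt_relations E lab alphabet \<B>"
  then have "?W x"
    by cases (simp only:, intro d p m su P S R R' Int_closed Un_closed empty_in; blast intro: rg ol)+
  then show "x \<in> carrier (free_algebra ?X)" by (simp add: free_algebra_def)
qed

lemma nonunital_ring_leavitt:
  "nonunital_ring (leavitt_labelled_path_algebra TYPE('k::field) E lab alphabet \<B>)"
  unfolding leavitt_labelled_path_algebra_def presented_algebra_def
  by (intro nonunital_ring_quotient algebra_ideal_hull leavitt_relations_subset)

end

end

theory Submission
  imports Defs
begin

text \<open>
  The algebra is \<open>\<int>\<close>-graded, with \<open>p\<^sub>A\<close>, \<open>s\<^sub>a\<close>, \<open>s\<^sub>a\<^sup>*\<close> in degrees \<open>0\<close>, \<open>1\<close>, \<open>-1\<close>, because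
  every defining relation is homogeneous.  Two facts about this grading give the result.

  First, every homogeneous element \<open>x\<close> is von Neumann regular, that is, \<open>x = x y x\<close> for some \<open>y\<close>
  (\<open>level_regular\<close>).  A homogeneous element is a combination of terms
  \<open>s\<^sub>\<alpha> p\<^sub>A s\<^sub>\<beta>\<^sup>*\<close> with \<open>|\<alpha>| - |\<beta>|\<close> fixed, and the proof is an induction on the length of \<open>\<beta>\<close>.
  For a finite set \<open>F\<close> of letters the idempotent \<open>e = \<Sum>\<^bsub>a \<in> F\<^esub> s\<^sub>a s\<^sub>a\<^sup>*\<close> commutes with
  all \<open>p\<^sub>A\<close>.  When \<open>F\<close> is large, \<open>x (1 - e)\<close> only sees the terms with empty \<open>\<beta>\<close>, while \<open>x e\<close>
  is the sum of the blocks \<open>(x s\<^sub>a) s\<^sub>a\<^sup>*\<close>, where \<open>x s\<^sub>a\<close> has shorter words \<open>\<beta>\<close>.  The blocks are treated one at a time by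
  McCoy's lemma: \<open>x\<close> is regular as soon as \<open>x - x y x\<close> is regular for some \<open>y\<close>
  (\<open>McCoy_inner_inverse\<close>), and a good choice of \<open>y\<close> makes one block of the difference vanish.
  Once all words \<open>\<beta>\<close> are empty, the words \<open>\<alpha>\<close> are removed in the same way from the left.  At the
  bottom of the induction stand the combinations of the commuting idempotents \<open>p\<^sub>A\<close>, which
  are step functions on a ring of sets with values in a field, so that each nonzero value can be
  inverted.

  Second, a \<open>\<int>\<close>-graded ring whose homogeneous elements are von Neumann regular has no nonzero
  quasi-regular ideal (\<open>semiprimitive_if_homogeneous_regular\<close>).  In such an ideal take a nonzero
  element with as few homogeneous components as possible.  After multiplication by a quasi-inverse
  its lowest component is an idempotent \<open>e\<close>, of degree \<open>0\<close>.  If that is the only component, then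
  \<open>e\<close> is a quasi-regular idempotent and vanishes.  Otherwise minimality forces the top component
  to commute with one of its own quasi-inverses, so that it is invertible in a corner of the ring.
  Multiples of the element then behave like Laurent polynomials whose extreme coefficients are
  units, and comparison of lowest and highest degrees shows that a suitable multiple is not
  quasi-regular.
\<close>

section \<open>Graded rings with regular homogeneous elements\<close>

context nonunital_ring
begin

lemma null_mult:
  assumes "x \<in> carrier R" shows "\<zero> \<otimes> x = \<zero>" "x \<otimes> \<zero> = \<zero>"
proof -
  have "\<zero> \<otimes> x \<oplus> \<zero> \<otimes> x = \<zero> \<otimes> x" "x \<otimes> \<zero> \<oplus> x \<otimes> \<zero> = x \<otimes> \<zero>"
    using l_distr[of \<zero> \<zero> x] r_distr[of \<zero> \<zero> x] assms by simp_all
  then show "\<zero> \<otimes> x = \<zero>" "x \<otimes> \<zero> = \<zero>"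
    using assms m_closed by simp_all
qed

lemma diff_eq_zero:
  assumes "x \<in> carrier R" "y \<in> carrier R" "x \<ominus> y = \<zero>" shows "x = y"
  using assms by (metis a_inv_closed a_minus_def minus_equality minus_minus)

lemma zero_quasi_regular_ideal: "quasi_regular_ideal R {\<zero>}"
proof -
  have "nonunital_ideal {\<zero>} R"
    by (intro nonunital_ideal.intro nonunital_ideal_axioms.intro additive_subgroup.intro
        nonunital_ring_axioms add.triv_subgroup)
      (auto simp: null_mult)
  then show ?thesis
    by (auto simp: quasi_regular_ideal_def right_quasi_regular_def left_quasi_regular_def
        null_mult a_minus_def intro!: bexI[of _ \<zero>])
qed

text \<open>Under the assumption the zero ideal is itself the greatest quasi-regular ideal.\<close>

lemma semiprimitiveI:
  assumes "\<And>I. quasi_regular_ideal R I \<Longrightarrow> I \<subseteq> {\<zero>}"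
  shows "semiprimitive R"
  unfolding semiprimitive_def jacobson_radical_def
  using zero_quasi_regular_ideal assms by (rule Greatest_equality)

lemma quasi_regular_idempotent:
  assumes "right_quasi_regular R e" "e \<in> carrier R" "e \<otimes> e = e"
  shows "e = \<zero>"
proof -
  obtain z where z: "z \<in> carrier R" "(e \<oplus> z) \<ominus> (e \<otimes> z) = \<zero>"
    using assms by (auto simp: right_quasi_regular_def)
  have "e \<oplus> z = e \<otimes> z" using diff_eq_zero[OF _ _ z(2)] assms z m_closed by simp
  then have "e \<otimes> (e \<oplus> z) = e \<otimes> (e \<otimes> z)" by simp
  then have "e \<oplus> e \<otimes> z = e \<otimes> z" using assms z by (simp add: r_distr flip: m_assoc)
  then show ?thesis using assms z m_closed by (simp add: add.r_cancel_one')
qed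

end

text \<open>
  A \<open>\<int>\<close>-grading in terms of its component projections, which avoids direct sums.  The two
  multiplication axioms, for one homogeneous factor, determine the components of every product
  because each element is a finite sum of its components.
\<close>

locale Z_graded_ring = nonunital_ring R for R (structure) +
  fixes comp :: "int \<Rightarrow> 'a \<Rightarrow> 'a"
  assumes comp_closed: "x \<in> carrier R \<Longrightarrow> comp n x \<in> carrier R"
    and comp_add: "x \<in> carrier R \<Longrightarrow> y \<in> carrier R \<Longrightarrow> comp n (x \<oplus> y) = comp n x \<oplus> comp n y"
    and comp_comp: "x \<in> carrier R \<Longrightarrow> comp m (comp n x) = (if m = n then comp n x else \<zero>)"
    and finite_support: "x \<in> carrier R \<Longrightarrow> finite {n. comp n x \<noteq> \<zero>}"
    and comp_separates: "x \<in> carrier R \<Longrightarrow> (\<And>n. comp n x = \<zero>) \<Longrightarrow> x = \<zero>"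
    and comp_mult_left: "x \<in> carrier R \<Longrightarrow> y \<in> carrier R \<Longrightarrow>
      comp n (comp m x \<otimes> y) = comp m x \<otimes> comp (n - m) y"
    and comp_mult_right: "x \<in> carrier R \<Longrightarrow> y \<in> carrier R \<Longrightarrow>
      comp n (x \<otimes> comp m y) = comp (n - m) x \<otimes> comp m y"
begin

lemma comp_zero: "comp n \<zero> = \<zero>"
  using comp_add[of \<zero> \<zero> n] comp_closed[of \<zero> n] by simp

lemma comp_minus: "x \<in> carrier R \<Longrightarrow> comp n (\<ominus> x) = \<ominus> (comp n x)"
  using comp_add[of "\<ominus> x" x n] comp_closed by (simp add: l_neg comp_zero minus_equality)

lemma comp_diff:
  "x \<in> carrier R \<Longrightarrow> y \<in> carrier R \<Longrightarrow> comp n (x \<ominus> y) = comp n x \<ominus> comp n y"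
  by (simp add: a_minus_def comp_add comp_minus)

lemma comp_eqI:
  assumes "x \<in> carrier R" "y \<in> carrier R" "\<And>n. comp n x = comp n y" shows "x = y"
  using diff_eq_zero[OF assms(1,2)] comp_separates[of "x \<ominus> y"] assms comp_closed
  by (simp add: a_minus_def comp_add comp_minus r_neg)

definition support :: "'a \<Rightarrow> int set" where "support x = {n. comp n x \<noteq> \<zero>}"

lemma support_finite: "x \<in> carrier R \<Longrightarrow> finite (support x)"
  by (simp add: support_def finite_support)

lemma support_nonempty: "x \<in> carrier R \<Longrightarrow> x \<noteq> \<zero> \<Longrightarrow> support x \<noteq> {}"
  using comp_separates by (auto simp: support_def)

lemma homogeneous_mult:
  assumes "x \<in> carrier R" "y \<in> carrier R" "comp m x = x"
  shows "comp n (x \<otimes> y) = x \<otimes> comp (n - m) y" "comp n (y \<otimes> x) = comp (n - m) y \<otimes> x"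
  using comp_mult_left[of x y n m] comp_mult_right[of y x n m] assms by simp_all

lemma homogeneous_mult_homogeneous:
  assumes "x \<in> carrier R" "y \<in> carrier R" "comp m x = x" "comp n y = y" "k = m + n"
  shows "comp k (x \<otimes> y) = x \<otimes> y"
  using homogeneous_mult(1)[OF assms(1-3)] assms by simp

lemma comp_other: "x \<in> carrier R \<Longrightarrow> comp m x = x \<Longrightarrow> n \<noteq> m \<Longrightarrow> comp n x = \<zero>"
  using comp_comp[of x n m] by simp

text \<open>
  This covers the degrees at the two ends of a product, where at most one pair of components of
  the factors can contribute.
\<close>

lemma comp_mult_single:
  assumes "x \<in> carrier R" "y \<in> carrier R"
    and "\<And>i. i \<noteq> a \<Longrightarrow> comp i x = \<zero> \<or> comp (n - i) y = \<zero>"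
  shows "comp n (x \<otimes> y) = comp a x \<otimes> comp (n - a) y"
proof -
  have "finite S \<Longrightarrow> x \<in> carrier R \<Longrightarrow> support x \<subseteq> S \<Longrightarrow>
      (\<And>i. i \<noteq> a \<Longrightarrow> comp i x = \<zero> \<or> comp (n - i) y = \<zero>) \<Longrightarrow>
      comp n (x \<otimes> y) = comp a x \<otimes> comp (n - a) y" for S
  proof (induction S arbitrary: x rule: finite_induct)
    case empty
    then have "x = \<zero>" using support_nonempty by blast
    then show ?case using assms(2) comp_closed by (simp add: null_mult comp_zero)
  next
    case (insert i S)
    let ?x = "x \<ominus> comp i x"
    have x: "x \<in> carrier R" "?x \<in> carrier R" "comp i x \<in> carrier R"
      using insert comp_closed by (auto simp: a_minus_def)
    have c: "comp j ?x = (if j = i then \<zero> else comp j x)" for j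
      using x comp_closed by (simp add: a_minus_def comp_add comp_minus comp_comp r_neg)
    have "x = ?x \<oplus> comp i x" using x by (simp add: a_minus_def a_assoc l_neg)
    then have "comp n (x \<otimes> y) = comp n (?x \<otimes> y) \<oplus> comp n (comp i x \<otimes> y)"
      using x assms(2) l_distr comp_add m_closed by metis
    also have "comp n (comp i x \<otimes> y) = comp i x \<otimes> comp (n - i) y"
      using x assms(2) by (simp add: comp_mult_left)
    also have "comp n (?x \<otimes> y) = comp a ?x \<otimes> comp (n - a) y"
    proof (rule insert.IH[OF x(2)])
      show "support ?x \<subseteq> S" using insert.prems(2) c by (auto simp: support_def)
    qed (use insert.prems(3) c in auto)
    finally have eq: "comp n (x \<otimes> y) = comp a ?x \<otimes> comp (n - a) y \<oplus> comp i x \<otimes> comp (n - i) y" .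
    have cl: "comp j x \<in> carrier R" "comp j y \<in> carrier R" for j
      using x assms(2) comp_closed by auto
    show ?case
    proof (cases "i = a")
      case True
      then show ?thesis using cl m_closed c[of i] by (simp add: eq null_mult flip: True)
    next
      case False
      then have "comp i x \<otimes> comp (n - i) y = \<zero>"
        using insert.prems(3)[of i] cl by (auto simp: null_mult)
      then show ?thesis using cl m_closed False by (simp add: eq c)
    qed
  qed
  from this[OF support_finite[OF assms(1)] assms(1) order_refl assms(3)] show ?thesis .
qed

text \<open>
  Any \<open>y\<close> with \<open>x y x = x\<close> may be replaced by its component \<open>u\<close> of the opposite degree, and then
  by \<open>u x u\<close>, which is also regular with quasi-inverse \<open>x\<close>.
\<close>

lemma homogeneous_quasi_inverse:
  assumes "x \<in> carrier R" "comp n x = x" and y: "y \<in> carrier R" "x \<otimes> y \<otimes> x = x"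
  obtains z where "z \<in> carrier R" "comp (- n) z = z" "x \<otimes> z \<otimes> x = x" "z \<otimes> x \<otimes> z = z"
proof -
  define u where "u = comp (- n) y"
  have u: "u \<in> carrier R" "comp (- n) u = u"
    using y comp_closed by (simp_all add: u_def comp_comp)
  note cl = assms(1) y(1) u(1) m_closed
  have "comp n (x \<otimes> (y \<otimes> x)) = x \<otimes> (u \<otimes> x)"
    using cl assms(2) by (simp add: homogeneous_mult[of x _ n] u_def)
  then have xux: "x \<otimes> u \<otimes> x = x" using y(2) assms cl by (simp add: m_assoc)
  show ?thesis
  proof (rule that[of "u \<otimes> x \<otimes> u"])
    show "comp (- n) (u \<otimes> x \<otimes> u) = u \<otimes> x \<otimes> u"
      using cl u(2) assms(2) by (simp add: m_assoc homogeneous_mult_homogeneous[where m = "- n" and n = 0]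
          homogeneous_mult_homogeneous[where m = n and n = "- n"])
    have "x \<otimes> (u \<otimes> x \<otimes> u) \<otimes> x = (x \<otimes> u \<otimes> x) \<otimes> u \<otimes> x" using cl by (simp add: m_assoc)
    then show "x \<otimes> (u \<otimes> x \<otimes> u) \<otimes> x = x" using xux by simp
    have "u \<otimes> x \<otimes> u \<otimes> x \<otimes> (u \<otimes> x \<otimes> u) = u \<otimes> ((x \<otimes> u \<otimes> x) \<otimes> u \<otimes> x) \<otimes> u"
      using cl by (simp add: m_assoc)
    then show "u \<otimes> x \<otimes> u \<otimes> x \<otimes> (u \<otimes> x \<otimes> u) = u \<otimes> x \<otimes> u" using xux by simp
  qed (use cl in simp)
qed

text \<open>
  This replaces Bergman's theorem that the Jacobson radical of a \<open>\<int>\<close>-graded ring is a graded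
  ideal: with regular homogeneous elements, a direct argument with an element of minimal support
  leads to a contradiction.
\<close>

theorem semiprimitive_if_homogeneous_regular:
  assumes regular: "\<And>n x. x \<in> carrier R \<Longrightarrow> comp n x = x \<Longrightarrow> \<exists>y\<in>carrier R. x \<otimes> y \<otimes> x = x"
  shows "semiprimitive R"
proof (rule semiprimitiveI, rule ccontr)
  fix I assume qr: "quasi_regular_ideal R I" and "\<not> I \<subseteq> {\<zero>}"
  then interpret I: nonunital_ideal I R by (simp add: quasi_regular_ideal_def)
  have Ic: "x \<in> carrier R" if "x \<in> I" for x using that I.a_subset by blast
  have I_diff: "x \<ominus> y \<in> I" if "x \<in> I" "y \<in> I" for x y
    using that by (simp add: a_minus_def)
  have rq: "right_quasi_regular R x" if "x \<in> I" for x
    using qr that by (simp add: quasi_regular_ideal_def)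
  note ICl = I.I_l_closed I.I_r_closed
  obtain x where x: "x \<in> I" "x \<noteq> \<zero>"
    and min: "\<And>y. y \<in> I \<Longrightarrow> y \<noteq> \<zero> \<Longrightarrow> card (support x) \<le> card (support y)"
  proof -
    obtain x0 where "x0 \<in> I \<and> x0 \<noteq> \<zero>" using \<open>\<not> I \<subseteq> {\<zero>}\<close> by blast
    from ex_has_least_nat[where P = "\<lambda>x. x \<in> I \<and> x \<noteq> \<zero>", OF this, of "\<lambda>x. card (support x)"]
    show ?thesis using that by blast
  qed
  have xc: "x \<in> carrier R" using x Ic by blast
  define m where "m = Min (support x)"
  have m: "m \<in> support x" "\<And>i. i < m \<Longrightarrow> comp i x = \<zero>"
  proof -
    show "m \<in> support x" using Min_in support_finite support_nonempty x xc by (simp add: m_def)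
    fix i assume "i < m" then show "comp i x = \<zero>"
      using Min_le[OF support_finite[OF xc], of i] by (force simp: m_def support_def)
  qed
  define xm where "xm = comp m x"
  have xm: "xm \<in> carrier R" "comp m xm = xm" "xm \<noteq> \<zero>"
    using xc comp_closed m(1) by (simp_all add: xm_def comp_comp support_def)
  obtain y where y: "y \<in> carrier R" "comp (- m) y = y" "xm \<otimes> y \<otimes> xm = xm" "y \<otimes> xm \<otimes> y = y"
    using homogeneous_quasi_inverse regular xm by metis
  define e where "e = y \<otimes> xm"
  have e: "e \<in> carrier R" "comp 0 e = e" "e \<otimes> e = e" "e \<otimes> y = y" "e \<noteq> \<zero>"
  proof -
    show "e \<in> carrier R" "comp 0 e = e" "e \<otimes> y = y"
      using y xm m_closed by (simp_all add: e_def homogeneous_mult_homogeneous[where m = "- m" and n = m])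
    have "e \<otimes> e = y \<otimes> (xm \<otimes> y \<otimes> xm)" using y(1) xm(1) m_closed by (simp add: e_def m_assoc)
    then show "e \<otimes> e = e" using y(3) by (simp add: e_def)
    have "xm \<otimes> e = xm" using y xm m_closed by (simp add: e_def m_assoc)
    then show "e \<noteq> \<zero>" using xm null_mult by auto
  qed
  \<comment> \<open>The lowest component becomes the idempotent \<open>e\<close>, and \<open>x'\<close> lies in the corner ring of \<open>e\<close>.\<close>
  define x' where "x' = y \<otimes> (x \<otimes> e)"
  have x'I: "x' \<in> I" using x y e by (simp add: x'_def ICl)
  then have x'c: "x' \<in> carrier R" by (rule Ic)
  have compx': "comp i x' = y \<otimes> (comp (i + m) x \<otimes> e)" for i
    using y xc e m_closed
    by (simp add: x'_def homogeneous_mult(1)[of y _ "- m"] homogeneous_mult(2)[of e _ 0])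
  have x'0: "comp 0 x' = e"
    using y(1) e xm m_closed by (simp add: compx' flip: xm_def) (simp add: e_def flip: m_assoc)
  have x'neg: "comp i x' = \<zero>" if "i < 0" for i
    using m(2)[of "i + m"] that y e by (simp add: compx' null_mult)
  have ex': "e \<otimes> comp i x' = comp i x'" "comp i x' \<otimes> e = comp i x'" for i
  proof -
    have "e \<otimes> comp i x' = e \<otimes> y \<otimes> (comp (i + m) x \<otimes> e)"
      "comp i x' \<otimes> e = y \<otimes> (comp (i + m) x \<otimes> (e \<otimes> e))"
      using y(1) e(1) xc comp_closed m_closed by (simp_all add: compx' m_assoc)
    then show "e \<otimes> comp i x' = comp i x'" "comp i x' \<otimes> e = comp i x'"
      by (simp_all add: e compx')
  qed
  have "support x' \<subseteq> (\<lambda>i. i - m) ` support x"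
  proof
    fix i assume "i \<in> support x'"
    then have "i + m \<in> support x" using y e by (auto simp: support_def compx' null_mult)
    then show "i \<in> (\<lambda>i. i - m) ` support x" by (intro image_eqI[of _ _ "i + m"]) auto
  qed
  then have card_x': "card (support x') \<le> card (support x)"
    using support_finite[OF xc] surj_card_le by blast
  have zero_x': "0 \<in> support x'" using e by (simp add: support_def x'0)
  define n where "n = Max (support x')"
  have n: "n \<in> support x'" "\<And>i. i > n \<Longrightarrow> comp i x' = \<zero>" "n \<ge> 0"
  proof -
    note fin = support_finite[OF x'c]
    show "n \<in> support x'" "n \<ge> 0" using Max_in[OF fin] Max_ge[OF fin] zero_x' by (auto simp: n_def)
    fix i assume "i > n" then show "comp i x' = \<zero>"
      using Max_ge[OF fin, of i] by (force simp: n_def support_def)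
  qed
  show False
  proof (cases "n = 0")
    case True
    have "x' = e"
    proof (rule comp_eqI[OF x'c e(1)])
      fix i show "comp i x' = comp i e"
        using x'0 x'neg n(2) True e comp_other[OF e(1,2)] by (cases i "0::int" rule: linorder_cases) auto
    qed
    then show False using quasi_regular_idempotent[OF rq] x'I e by blast
  next
    case False
    then have npos: "n > 0" using n(3) by simp
    define c where "c = comp n x'"
    have c: "c \<in> carrier R" "comp n c = c" "c \<noteq> \<zero>" "e \<otimes> c = c" "c \<otimes> e = c"
      using x'c comp_closed n(1) ex' by (simp_all add: c_def comp_comp support_def)
    obtain h where h: "h \<in> carrier R" "comp (- n) h = h" "c \<otimes> h \<otimes> c = c"
      using homogeneous_quasi_inverse regular c(1,2) by metis
    define g where "g = e \<otimes> (h \<otimes> e)"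
    have g: "g \<in> carrier R" "comp (- n) g = g" "e \<otimes> g = g" "g \<otimes> e = g"
    proof -
      show "g \<in> carrier R" using e h m_closed by (simp add: g_def)
      show "comp (- n) g = g" using e h m_closed
        by (simp add: g_def homogeneous_mult_homogeneous[where m = 0 and n = "- n"]
            homogeneous_mult_homogeneous[where m = "- n" and n = 0])
      have "e \<otimes> g = e \<otimes> e \<otimes> (h \<otimes> e)" using e(1) h(1) m_closed by (simp add: g_def m_assoc)
      then show "e \<otimes> g = g" using e by (simp add: g_def)
      have "g \<otimes> e = e \<otimes> (h \<otimes> (e \<otimes> e))" using e(1) h(1) m_closed by (simp add: g_def m_assoc)
      then show "g \<otimes> e = g" using e by (simp add: g_def)
    qed
    have cgc: "c \<otimes> (g \<otimes> c) = c"
    proof -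
      have "c \<otimes> (g \<otimes> c) = (c \<otimes> e) \<otimes> h \<otimes> (e \<otimes> c)"
        using c(1) e(1) h(1) m_closed by (simp add: g_def m_assoc)
      then show ?thesis using c h by simp
    qed
    have cg: "c \<otimes> g = g \<otimes> c"
    proof -
      \<comment> \<open>In the commutator with \<open>g\<close> the component that comes from \<open>e\<close> cancels, and \<open>z\<close> is too short
        to be nonzero.\<close>
      define z where "z = x' \<otimes> g \<ominus> g \<otimes> x'"
      have zI: "z \<in> I" using x'I g by (simp add: z_def I_diff ICl)
      have compz: "comp i z = comp (i + n) x' \<otimes> g \<ominus> g \<otimes> comp (i + n) x'" for i
        using x'c g m_closed by (simp add: z_def comp_diff homogeneous_mult[of g _ "- n"])
      have "support z \<subseteq> (\<lambda>i. i - n) ` (support x' - {0})"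
      proof
        fix i assume i: "i \<in> support z"
        have "i + n \<in> support x'"
          using i g by (auto simp: support_def compz null_mult a_minus_def)
        moreover have "i + n \<noteq> 0"
          using i g by (auto simp: support_def compz x'0 a_minus_def r_neg)
        ultimately show "i \<in> (\<lambda>i. i - n) ` (support x' - {0})"
          by (intro image_eqI[of _ _ "i + n"]) auto
      qed
      then have "card (support z) \<le> card (support x' - {0})"
        using support_finite[OF x'c] surj_card_le by blast
      also have "\<dots> < card (support x')"
        using zero_x' support_finite[OF x'c] by (rule card_Diff1_less[rotated])
      finally have "z = \<zero>" using min[OF zI] card_x' by fastforce
      then have "comp 0 z = \<zero>" by (simp add: comp_zero)
      then show ?thesis
        using diff_eq_zero c(1) g(1) m_closed by (simp add: compz flip: c_def)
    qed
    \<comment> \<open>In the corner of the idempotent \<open>f\<close>, the element \<open>c\<close> is invertible with inverse \<open>f g\<close>.\<close>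
    define f where "f = c \<otimes> g"
    have f: "f \<in> carrier R" "comp 0 f = f" "f \<otimes> f = f" "f \<otimes> c = c"
    proof -
      show "f \<in> carrier R" "comp 0 f = f"
        using c g m_closed by (simp_all add: f_def homogeneous_mult_homogeneous[where m = n and n = "- n"])
      show fc: "f \<otimes> c = c" using c(1) g(1) cgc by (simp add: f_def m_assoc)
      have "f \<otimes> f = (f \<otimes> c) \<otimes> g" using c(1) g(1) m_closed by (simp add: f_def m_assoc)
      then show "f \<otimes> f = f" by (simp only: fc flip: f_def)
    qed
    \<comment> \<open>All components of \<open>w\<close> have positive degree, and the top one is the unit \<open>c\<^sup>2\<close> of the corner.\<close>
    define w where "w = f \<otimes> (x' \<otimes> c)"
    have wI: "w \<in> I" using x'I f c by (simp add: w_def ICl)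
    then have wc: "w \<in> carrier R" by (rule Ic)
    have compw: "comp i w = f \<otimes> (comp (i - n) x' \<otimes> c)" for i
      using f c x'c m_closed
      by (simp add: w_def homogeneous_mult(1)[of f _ 0] homogeneous_mult(2)[of c _ n])
    have w_below: "comp i w = \<zero>" if "i < n" for i
      using x'neg[of "i - n"] that f c by (simp add: compw null_mult)
    have w_above: "comp i w = \<zero>" if "i > 2 * n" for i
      using n(2)[of "i - n"] that f c by (simp add: compw null_mult)
    have w_top: "comp (2 * n) w = c \<otimes> c"
      using f c by (simp add: compw flip: c_def m_assoc)
    have fw: "f \<otimes> w = w"
    proof -
      have "f \<otimes> w = f \<otimes> f \<otimes> (x' \<otimes> c)" using f(1) x'c c(1) m_closed by (simp add: w_def m_assoc)
      then show ?thesis by (simp add: f w_def)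
    qed
    obtain v where v: "v \<in> carrier R" "(w \<oplus> v) \<ominus> (w \<otimes> v) = \<zero>"
      using rq[OF wI] by (auto simp: right_quasi_regular_def)
    have wv: "w \<oplus> v = w \<otimes> v" using diff_eq_zero[OF _ _ v(2)] wc v m_closed by simp
    have compwv: "comp i w \<oplus> comp i v = comp i (w \<otimes> v)" for i
      using wv wc v by (metis comp_add)
    have fv: "f \<otimes> v = v"
    proof -
      have "w \<oplus> f \<otimes> v = f \<otimes> (w \<oplus> v)" using f(1) wc v(1) fw by (simp add: r_distr)
      also have "\<dots> = w \<oplus> v" using f(1) wc v(1) fw by (simp add: wv flip: m_assoc)
      finally show ?thesis using f(1) wc v(1) m_closed by simp
    qed
    have cancel: "u = \<zero>" if "u \<in> carrier R" "f \<otimes> u = u" "c \<otimes> (c \<otimes> u) = \<zero>" for u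
    proof -
      have "u = f \<otimes> (f \<otimes> u)" using that by simp
      also have "\<dots> = g \<otimes> c \<otimes> (g \<otimes> c \<otimes> u)" by (simp add: f_def cg)
      also have "\<dots> = g \<otimes> (c \<otimes> g \<otimes> (c \<otimes> u))"
        using that(1) c(1) g(1) m_closed by (simp add: m_assoc)
      also have "\<dots> = g \<otimes> (g \<otimes> (c \<otimes> (c \<otimes> u)))"
        unfolding cg using that(1) c(1) g(1) m_closed by (simp add: m_assoc)
      finally show ?thesis using that g by (simp add: null_mult)
    qed
    have "v \<noteq> \<zero>"
    proof
      assume "v = \<zero>"
      then have "w = \<zero>" using wv wc by (simp add: null_mult)
      then have "c \<otimes> c = \<zero>" using w_top by (simp add: comp_zero)
      then have "c = \<zero>" using cancel[of c] c f by (simp add: null_mult)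
      then show False using c by simp
    qed
    define lo where "lo = Min (support v)"
    define hi where "hi = Max (support v)"
    note fin = support_finite[OF v(1)] and ne = support_nonempty[OF v(1) \<open>v \<noteq> \<zero>\<close>]
    have lo: "lo \<in> support v" "\<And>i. i < lo \<Longrightarrow> comp i v = \<zero>"
      using Min_in[OF fin ne] Min_le[OF fin] by (force simp: lo_def support_def)+
    have hi: "hi \<in> support v" "\<And>i. i > hi \<Longrightarrow> comp i v = \<zero>"
      using Max_in[OF fin ne] Max_ge[OF fin] by (force simp: hi_def support_def)+
    \<comment> \<open>The product \<open>w v\<close> starts strictly above \<open>v\<close>, so that in \<open>w + v = w v\<close> the lowest component of \<open>v\<close>
      must cancel against one of \<open>w\<close>.\<close>
    have "lo \<ge> n"
    proof (rule ccontr)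
      assume "\<not> lo \<ge> n"
      then have "comp lo w = \<zero>" using w_below by simp
      moreover have "comp lo (w \<otimes> v) = comp 0 w \<otimes> comp (lo - 0) v"
      proof (rule comp_mult_single[OF wc v(1)])
        fix i show "comp i w = \<zero> \<or> comp (lo - i) v = \<zero>"
          using w_below[of i] lo(2)[of "lo - i"] npos by (cases "i < n") auto
      qed
      moreover have "comp 0 w = \<zero>" using w_below npos by simp
      ultimately have "comp lo v = \<zero>"
        using compwv[of lo] v(1) comp_closed by (simp add: null_mult)
      then show False using lo(1) by (simp add: support_def)
    qed
    moreover have "lo \<le> hi" using Min_le[OF fin hi(1)] by (simp add: lo_def)
    ultimately have "hi \<ge> n" by simp
    \<comment> \<open>At the other end \<open>w v\<close> reaches strictly above both \<open>w\<close> and \<open>v\<close>.\<close>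
    have "comp (2 * n + hi) (w \<otimes> v) = comp (2 * n) w \<otimes> comp (2 * n + hi - 2 * n) v"
    proof (rule comp_mult_single[OF wc v(1)])
      fix i assume "i \<noteq> 2 * n"
      then show "comp i w = \<zero> \<or> comp (2 * n + hi - i) v = \<zero>"
        using w_above[of i] hi(2)[of "2 * n + hi - i"] by (cases "i < 2 * n") auto
    qed
    moreover have "comp (2 * n + hi) w = \<zero>" "comp (2 * n + hi) v = \<zero>"
      using w_above hi(2) npos \<open>hi \<ge> n\<close> by simp_all
    ultimately have "c \<otimes> (c \<otimes> comp hi v) = \<zero>"
      using compwv[of "2 * n + hi"] c(1) v(1) comp_closed by (simp add: w_top m_assoc)
    moreover have "f \<otimes> comp hi v = comp hi v"
      using homogeneous_mult(1)[OF f(1) v(1) f(2), of hi] fv by simp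
    ultimately have "comp hi v = \<zero>" using cancel v(1) comp_closed by blast
    then show False using hi(1) by (simp add: support_def)
  qed
qed

end


section \<open>Von Neumann regularity modulo an ideal\<close>

text \<open>
  Quotients by an ideal that depends on parameters are not types.  Congruence modulo the ideal
  keeps the arithmetic of the ambient unital ring available, in particular elements \<open>1 - e\<close>.
\<close>

locale ring_ideal =
  fixes H :: "'a::ring_1 set"
  assumes zero_in: "0 \<in> H"
    and diff_in: "x \<in> H \<Longrightarrow> y \<in> H \<Longrightarrow> x - y \<in> H"
    and mult_left_in: "y \<in> H \<Longrightarrow> x * y \<in> H"
    and mult_right_in: "x \<in> H \<Longrightarrow> x * y \<in> H"
begin

definition congr :: "'a \<Rightarrow> 'a \<Rightarrow> bool" (infix \<open>\<approx>\<close> 50)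
  where "x \<approx> y \<longleftrightarrow> x - y \<in> H"

lemma congr_refl [simp, intro!]: "x \<approx> x"
  by (simp add: congr_def zero_in)

lemma congr_sym: "x \<approx> y \<Longrightarrow> y \<approx> x"
  using diff_in[OF zero_in, of "x - y"] by (simp add: congr_def)

lemma add_in: "x \<in> H \<Longrightarrow> y \<in> H \<Longrightarrow> x + y \<in> H"
  using diff_in[of x "0 - y"] diff_in[OF zero_in] by simp

lemma congr_trans [trans]: "x \<approx> y \<Longrightarrow> y \<approx> z \<Longrightarrow> x \<approx> z"
  using add_in[of "x - y" "y - z"] by (simp add: congr_def)

lemma congr_add: "x \<approx> x' \<Longrightarrow> y \<approx> y' \<Longrightarrow> x + y \<approx> x' + y'"
  using add_in[of "x - x'" "y - y'"] by (simp add: congr_def algebra_simps)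

lemma congr_diff: "x \<approx> x' \<Longrightarrow> y \<approx> y' \<Longrightarrow> x - y \<approx> x' - y'"
  using diff_in[of "x - x'" "y - y'"] by (simp add: congr_def algebra_simps)

lemma congr_mult: "x \<approx> x' \<Longrightarrow> y \<approx> y' \<Longrightarrow> x * y \<approx> x' * y'"
  using add_in[OF mult_right_in[of "x - x'" y] mult_left_in[of "y - y'" x']]
  by (simp add: congr_def algebra_simps)

lemmas congr_intros = congr_mult congr_add congr_diff

lemma congr_sum: "(\<And>i. i \<in> F \<Longrightarrow> f i \<approx> g i) \<Longrightarrow> sum f F \<approx> sum g F"
  by (induction F rule: infinite_finite_induct) (auto intro: congr_add)

lemma congr_0_mult: "x \<approx> 0 \<Longrightarrow> x * y \<approx> 0"  "y \<approx> 0 \<Longrightarrow> x * y \<approx> 0"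
  using mult_left_in mult_right_in by (auto simp: congr_def)

text \<open>
  McCoy's lemma: if \<open>x - x y x\<close> is regular, with quasi-inverse \<open>w\<close>, then so is \<open>x\<close>.  The witness
  is \<open>y + (1 - y x) w (1 - x y)\<close>.
\<close>

lemma McCoy_inner_inverse:
  assumes "(x - x * y * x) * w * (x - x * y * x) \<approx> x - x * y * x"
  shows "x * (y + w - y * x * w - w * x * y + y * x * w * x * y) * x \<approx> x"
proof -
  have "x * (y + w - y * x * w - w * x * y + y * x * w * x * y) * x
      = x * y * x + (x - x * y * x) * w * (x - x * y * x)"
    by (simp add: algebra_simps)
  also have "\<dots> \<approx> x * y * x + (x - x * y * x)"
    by (intro congr_intros congr_refl assms)
  finally show ?thesis by simp
qed

lemma orthogonal_sum:
  assumes q: "q * q' \<approx> 0" "q' * q \<approx> 0"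
    and u: "q * u \<approx> u" "u * q \<approx> u" "u * y * u \<approx> u"
    and v: "q' * v \<approx> v" "v * q' \<approx> v" "v * y' * v \<approx> v"
  shows "(u + v) * (q * y * q + q' * y' * q') * (u + v) \<approx> u + v"
proof -
  have uq': "u * q' \<approx> 0" and vq: "v * q \<approx> 0" and q'u: "q' * u \<approx> 0" and qv: "q * v \<approx> 0"
  proof -
    have "u * q' \<approx> u * q * q'" by (intro congr_mult congr_sym[OF u(2)] congr_refl)
    also have "u * q * q' \<approx> 0" using q(1) congr_0_mult by (simp add: mult.assoc)
    finally show "u * q' \<approx> 0" .
    have "v * q \<approx> v * q' * q" by (intro congr_mult congr_sym[OF v(2)] congr_refl)
    also have "v * q' * q \<approx> 0" using q(2) congr_0_mult by (simp add: mult.assoc)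
    finally show "v * q \<approx> 0" .
    have "q' * u \<approx> q' * (q * u)" by (intro congr_mult congr_sym[OF u(1)] congr_refl)
    also have "q' * (q * u) \<approx> 0" using q(2) congr_0_mult by (simp flip: mult.assoc)
    finally show "q' * u \<approx> 0" .
    have "q * v \<approx> q * (q' * v)" by (intro congr_mult congr_sym[OF v(1)] congr_refl)
    also have "q * (q' * v) \<approx> 0" using q(1) congr_0_mult by (simp flip: mult.assoc)
    finally show "q * v \<approx> 0" .
  qed
  have "(u + v) * (q * y * q + q' * y' * q') * (u + v)
      = (u * q + v * q) * y * (q * u + q * v) + (u * q' + v * q') * y' * (q' * u + q' * v)"
    by (simp add: algebra_simps)
  also have "\<dots> \<approx> (u + 0) * y * (u + 0) + (0 + v) * y' * (0 + v)"
    by (intro congr_intros congr_refl u v uq' vq q'u qv)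
  also have "\<dots> \<approx> u + v"
    using congr_add[OF u(3) v(3)] by simp
  finally show ?thesis .
qed

end


section \<open>Graded presentations\<close>

text \<open>
  Both the homogeneous components of a noncommutative polynomial and the retraction that kills the
  words with letters outside \<open>X\<close> are restrictions of a polynomial to a set of words.
\<close>

definition restrict_keys :: "'a set \<Rightarrow> ('a \<Rightarrow>\<^sub>0 'b::zero) \<Rightarrow> 'a \<Rightarrow>\<^sub>0 'b" where
  "restrict_keys S f = Poly_Mapping.mapp (\<lambda>w c. c when w \<in> S) f"

lemma lookup_restrict_keys:
  "Poly_Mapping.lookup (restrict_keys S f) w = (Poly_Mapping.lookup f w when w \<in> S)"
  by (auto simp: restrict_keys_def lookup_mapp when_def in_keys_iff)

lemma keys_restrict_keys: "Poly_Mapping.keys (restrict_keys S f) = Poly_Mapping.keys f \<inter> S"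
  by (auto simp: in_keys_iff lookup_restrict_keys when_def split: if_splits)

lemma restrict_keys_eq_self: "Poly_Mapping.keys f \<subseteq> S \<Longrightarrow> restrict_keys S f = f"
  by (rule poly_mapping_eqI) (auto simp: lookup_restrict_keys when_def in_keys_iff)

lemma restrict_keys_eq_zero: "Poly_Mapping.keys f \<inter> S = {} \<Longrightarrow> restrict_keys S f = 0"
  by (rule poly_mapping_eqI) (auto simp: lookup_restrict_keys when_def in_keys_iff)

lemma restrict_keys_add:
  "restrict_keys S (f + g) = restrict_keys S f + restrict_keys S (g :: 'a \<Rightarrow>\<^sub>0 'b::monoid_add)"
  by (rule poly_mapping_eqI) (simp add: lookup_restrict_keys lookup_add when_def)

lemma restrict_keys_diff:
  "restrict_keys S (f - g) = restrict_keys S f - restrict_keys S (g :: 'a \<Rightarrow>\<^sub>0 'b::ab_group_add)"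
  by (rule poly_mapping_eqI) (simp add: lookup_restrict_keys lookup_minus when_def)

lemma restrict_keys_zero [simp]: "restrict_keys S 0 = 0"
  by (simp add: restrict_keys_eq_zero)

lemma restrict_keys_restrict_keys:
  "restrict_keys S (restrict_keys T f) = restrict_keys (S \<inter> T) f"
  by (rule poly_mapping_eqI) (simp add: lookup_restrict_keys when_def)

lemma restrict_keys_sum:
  "restrict_keys S (sum f I) = (\<Sum>i\<in>I. restrict_keys S (f i :: 'a \<Rightarrow>\<^sub>0 'b::comm_monoid_add))"
  by (induction I rule: infinite_finite_induct) (simp_all add: restrict_keys_add)

lemma restrict_keys_mult:
  fixes f g :: "'a::monoid_add \<Rightarrow>\<^sub>0 'b::ring"
  assumes "\<And>u v. u \<in> Poly_Mapping.keys f \<Longrightarrow> v \<in> Poly_Mapping.keys g \<Longrightarrow>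
    u + v \<in> S \<longleftrightarrow> u \<in> A \<and> v \<in> B"
  shows "restrict_keys S (f * g) = restrict_keys A f * restrict_keys B g"
proof -
  have split: "h = restrict_keys T h + restrict_keys (- T) h" for h :: "'a \<Rightarrow>\<^sub>0 'b" and T
    by (rule poly_mapping_eqI) (simp add: lookup_add lookup_restrict_keys when_def)
  have "f * g = restrict_keys A f * restrict_keys B g + restrict_keys A f * restrict_keys (- B) g
      + restrict_keys (- A) f * g"
    using split[of f A] split[of g B] by (metis distrib_left distrib_right)
  moreover have "restrict_keys S (restrict_keys A f * restrict_keys B g)
      = restrict_keys A f * restrict_keys B g"
    using keys_mult[of "restrict_keys A f" "restrict_keys B g"] assms
    by (intro restrict_keys_eq_self) (fastforce simp: keys_restrict_keys)
  moreover have "restrict_keys S (restrict_keys A f * restrict_keys (- B) g) = 0"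
    using keys_mult[of "restrict_keys A f" "restrict_keys (- B) g"] assms
    by (intro restrict_keys_eq_zero) (fastforce simp: keys_restrict_keys)
  moreover have "restrict_keys S (restrict_keys (- A) f * g) = 0"
    using keys_mult[of "restrict_keys (- A) f" g] assms
    by (intro restrict_keys_eq_zero) (fastforce simp: keys_restrict_keys)
  ultimately show ?thesis by (simp add: restrict_keys_add)
qed

lemma poly_mapping_sum_restrict_keys:
  assumes "finite I" "d ` Poly_Mapping.keys f \<subseteq> I"
  shows "(\<Sum>i\<in>I. restrict_keys {w. d w = i} f) = (f :: 'a \<Rightarrow>\<^sub>0 'b::comm_monoid_add)"
proof (rule poly_mapping_eqI)
  fix w
  have "Poly_Mapping.lookup (\<Sum>i\<in>I. restrict_keys {w. d w = i} f) w
      = (\<Sum>i\<in>I. if i = d w then Poly_Mapping.lookup f w else 0)"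
    unfolding lookup_sum by (intro sum.cong) (auto simp: lookup_restrict_keys when_def)
  also have "\<dots> = Poly_Mapping.lookup f w"
    using assms by (simp add: image_subset_iff) (metis in_keys_iff)
  finally show "Poly_Mapping.lookup (\<Sum>i\<in>I. restrict_keys {w. d w = i} f) w
      = Poly_Mapping.lookup f w" .
qed

lemma free_algebra_simps [simp]:
  "x \<oplus>\<^bsub>free_algebra X\<^esub> y = x + y" "x \<otimes>\<^bsub>free_algebra X\<^esub> y = x * y" "\<zero>\<^bsub>free_algebra X\<^esub> = 0"
  "c \<odot>\<^bsub>free_algebra X\<^esub> x = Poly_Mapping.single 0 c * x"
  by (simp_all add: free_algebra_def mult_map_scale_conv_mult)

lemma carrier_free_algebra: 
  "f \<in> carrier (free_algebra X) \<longleftrightarrow> Poly_Mapping.keys f \<subseteq> lists X - {[]}"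
  by (simp add: free_algebra_def)

lemma free_algebra_minus:
  assumes "x \<in> carrier (free_algebra X)"
  shows "\<ominus>\<^bsub>free_algebra X\<^esub> x = - (x :: _ \<Rightarrow>\<^sub>0 'k::field)"
proof -
  interpret nonunital_ring "free_algebra X :: ('k, _) module" by (rule nonunital_ring_free_algebra)
  show ?thesis using assms by (intro minus_equality) (auto simp: carrier_free_algebra)
qed

lemma single_zero_central:
  "f * Poly_Mapping.single 0 c = Poly_Mapping.single 0 c * (f :: _ list \<Rightarrow>\<^sub>0 'k::field)"
proof (induction f rule: update_induct)
  case const
  then show ?case by simp
next
  case (update f w d)
  have "Poly_Mapping.update w d f = f + Poly_Mapping.single w d"
    using update(1)
    by (intro poly_mapping_eqI) (auto simp: lookup_update lookup_add lookup_single when_def in_keys_iff)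
  then show ?case using update by (simp add: algebra_simps mult_single)
qed

text \<open>Negatives need no separate closure condition, since they are multiples by the scalar \<open>-1\<close>.\<close>

lemma algebra_ideal_freeI:
  fixes I :: "('g list \<Rightarrow>\<^sub>0 'k::field) set"
  assumes "I \<subseteq> carrier (free_algebra X)" "0 \<in> I"
    and add: "\<And>x y. x \<in> I \<Longrightarrow> y \<in> I \<Longrightarrow> x + y \<in> I"
    and scale: "\<And>c x. x \<in> I \<Longrightarrow> Poly_Mapping.single 0 c * x \<in> I"
    and "\<And>x y. x \<in> I \<Longrightarrow> y \<in> carrier (free_algebra X) \<Longrightarrow> y * x \<in> I"
    and "\<And>x y. x \<in> I \<Longrightarrow> y \<in> carrier (free_algebra X) \<Longrightarrow> x * y \<in> I"
  shows "algebra_ideal (free_algebra X) I"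
proof -
  interpret nonunital_ring "free_algebra X :: ('k, _) module" by (rule nonunital_ring_free_algebra)
  have "- x \<in> I" if "x \<in> I" for x
    using scale[OF that, of "- 1"] by (simp add: single_uminus)
  then have "\<ominus>\<^bsub>free_algebra X\<^esub> x \<in> I" if "x \<in> I" for x
    using that assms(1) free_algebra_minus by (metis subsetD)
  then have "additive_subgroup I (free_algebra X)"
    using assms by (intro additive_subgroup.intro add.subgroupI) (auto simp: a_inv_def)
  then show ?thesis
    using assms nonunital_ring_axioms
    by (auto simp: algebra_ideal_def nonunital_ideal_def nonunital_ideal_axioms_def)
qed

locale free_ideal =
  fixes X :: "'g set" and H :: "('g list \<Rightarrow>\<^sub>0 'k::field) set"
  assumes H: "algebra_ideal (free_algebra X) H"
begin

abbreviation F :: "('k, 'g list \<Rightarrow>\<^sub>0 'k) module" where "F \<equiv> free_algebra X"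

sublocale ideal: nonunital_ideal H F
  using H by (simp add: algebra_ideal_def)

lemma H_carrier: "x \<in> H \<Longrightarrow> x \<in> carrier F"
  using ideal.a_subset by blast

lemma H_zero: "0 \<in> H"
  using additive_subgroup.zero_closed[OF ideal.additive_subgroup_axioms] by simp

lemma H_add: "x \<in> H \<Longrightarrow> y \<in> H \<Longrightarrow> x + y \<in> H"
  using additive_subgroup.a_closed[OF ideal.additive_subgroup_axioms] by simp

lemma H_scale: "x \<in> H \<Longrightarrow> Poly_Mapping.single 0 c * x \<in> H"
  using H by (simp add: algebra_ideal_def)

lemma H_uminus: "x \<in> H \<Longrightarrow> - x \<in> H"
  using H_scale[of x "- 1"] by (simp add: single_uminus)

lemma H_diff: "x \<in> H \<Longrightarrow> y \<in> H \<Longrightarrow> x - y \<in> H"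
  using H_add[of x "- y"] H_uminus by simp

lemma H_sum: "(\<And>i. i \<in> I \<Longrightarrow> f i \<in> H) \<Longrightarrow> sum f I \<in> H"
  by (induction I rule: infinite_finite_induct) (auto simp: H_zero H_add)

text \<open>
  An ideal of the non-unital free algebra absorbs the unital one as well, because it is closed
  under scalars.
\<close>

lemma H_mult:
  assumes "x \<in> H" "Poly_Mapping.keys y \<subseteq> lists X" shows "y * x \<in> H" "x * y \<in> H"
proof -
  define c where "c = Poly_Mapping.lookup y 0"
  define y0 where "y0 = restrict_keys (- {[]}) y"
  have y: "y = Poly_Mapping.single 0 c + y0"
    by (rule poly_mapping_eqI)
      (auto simp: y0_def c_def lookup_add lookup_single lookup_restrict_keys when_def zero_list_def)
  have "y0 \<in> carrier F" using assms(2) by (auto simp: y0_def carrier_free_algebra keys_restrict_keys)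
  then have "y0 * x \<in> H" "x * y0 \<in> H"
    using assms(1) ideal.I_l_closed ideal.I_r_closed by simp_all
  moreover have "x * Poly_Mapping.single 0 c \<in> H"
    using H_scale[OF assms(1)] by (simp add: single_zero_central)
  ultimately show "y * x \<in> H" "x * y \<in> H"
    using assms(1) H_scale by (simp_all add: y distrib_left distrib_right H_add)
qed

abbreviation Q :: "('k, ('g list \<Rightarrow>\<^sub>0 'k) set) module" where "Q \<equiv> quotient_algebra F H"

definition coset :: "('g list \<Rightarrow>\<^sub>0 'k) \<Rightarrow> ('g list \<Rightarrow>\<^sub>0 'k) set" where "coset x = (\<lambda>h. h + x) ` H"

lemma coset_rcoset: "H +>\<^bsub>F\<^esub> x = coset x"
  by (auto simp: a_r_coset_def' coset_def)

lemma mem_coset: "y \<in> coset x \<longleftrightarrow> y - x \<in> H"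
  by (auto simp: coset_def image_iff algebra_simps) (metis diff_add_cancel)

lemma coset_eq_iff: "coset x = coset y \<longleftrightarrow> x - y \<in> H"
proof
  assume "coset x = coset y"
  then have "x \<in> coset y" using H_zero by (auto simp: mem_coset)
  then show "x - y \<in> H" by (simp add: mem_coset)
next
  assume xy: "x - y \<in> H"
  have "z - x \<in> H \<longleftrightarrow> z - y \<in> H" for z
    using H_add[OF _ xy, of "z - x"] H_diff[OF _ xy, of "z - y"] by auto
  then show "coset x = coset y" by (auto simp: mem_coset)
qed

lemma carrier_Q: "carrier Q = coset ` carrier F"
  by (auto simp: quotient_algebra_def ring.defs FactRing_def A_RCOSETS_def' coset_rcoset)

lemma Q_zero: "\<zero>\<^bsub>Q\<^esub> = coset 0"
  by (auto simp: quotient_algebra_def ring.defs FactRing_def coset_def)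

lemma Q_add:
  assumes "x \<in> carrier F" "y \<in> carrier F" shows "coset x \<oplus>\<^bsub>Q\<^esub> coset y = coset (x + y)"
  using ideal.abelian_subgroup_rcos_sum[OF assms]
  by (simp add: quotient_algebra_def ring.defs FactRing_def coset_rcoset)

lemma Q_mult:
  assumes "x \<in> carrier F" "y \<in> carrier F" shows "coset x \<otimes>\<^bsub>Q\<^esub> coset y = coset (x * y)"
  using ideal.rcoset_mult[OF assms]
  by (simp add: quotient_algebra_def ring.defs FactRing_def coset_rcoset)

text \<open>
  The retraction extends the ideal from the free algebra on \<open>X\<close> to the free unital algebra on all
  letters, which is a whole type, without changing it on the free algebra on \<open>X\<close>.  Congruence
  modulo the extended ideal therefore needs no membership conditions.
\<close>

definition retract :: "('g list \<Rightarrow>\<^sub>0 'k) \<Rightarrow> 'g list \<Rightarrow>\<^sub>0 'k" where "retract = restrict_keys (lists X)"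

lemma retract_mult: "retract (x * y) = retract x * retract y"
  unfolding retract_def by (rule restrict_keys_mult) (simp add: plus_list_def)

lemma retract_diff: "retract (x - y) = retract x - retract y"
  by (simp add: retract_def restrict_keys_diff)

lemma retract_keys: "Poly_Mapping.keys (retract x) \<subseteq> lists X"
  by (simp add: retract_def keys_restrict_keys)

lemma retract_carrier: "x \<in> carrier F \<Longrightarrow> retract x = x"
  by (auto simp: retract_def carrier_free_algebra intro!: restrict_keys_eq_self)

definition H_ext :: "('g list \<Rightarrow>\<^sub>0 'k) set" where "H_ext = {x. retract x \<in> H}"

lemma H_ext: "ring_ideal H_ext"
proof unfold_locales
  show "0 \<in> H_ext" by (simp add: H_ext_def retract_def H_zero)
qed (simp_all add: H_ext_def retract_diff retract_mult H_mult retract_keys H_diff)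

lemma H_subset_H_ext: "x \<in> H \<Longrightarrow> x \<in> H_ext"
  by (simp add: H_ext_def retract_carrier H_carrier)

text \<open>
  A quasi-inverse \<open>y\<close> found in the unital free algebra on all letters is pulled back to \<open>X\<close> by the
  retraction; replacing the result \<open>u\<close> by \<open>u x u\<close> removes its constant term.
\<close>

lemma regular_coset:
  assumes x: "x \<in> carrier F" and y: "x - x * y * x \<in> H_ext"
  shows "\<exists>z\<in>carrier Q. coset x \<otimes>\<^bsub>Q\<^esub> z \<otimes>\<^bsub>Q\<^esub> coset x = coset x"
proof -
  define u where "u = retract y"
  have d: "x - x * u * x \<in> H"
    using y x by (simp add: H_ext_def retract_diff retract_mult retract_carrier u_def)
  have xu: "Poly_Mapping.keys (x * u) \<subseteq> lists X"
    using retract_keys[of "x * u"] retract_carrier[OF x]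
    by (metis retract_mult retract_def restrict_keys_restrict_keys Int_absorb u_def)
  have z: "u * x * u \<in> carrier F"
    unfolding carrier_free_algebra
  proof
    fix w assume "w \<in> Poly_Mapping.keys (u * x * u)"
    then obtain a b c where w: "w = (a + b) + c" "a \<in> Poly_Mapping.keys u"
      "b \<in> Poly_Mapping.keys x" "c \<in> Poly_Mapping.keys u"
      using keys_mult[of "u * x" u] keys_mult[of u x] by blast
    then have "a \<in> lists X" "b \<in> lists X - {[]}" "c \<in> lists X"
      using x retract_keys[of y] unfolding carrier_free_algebra u_def by blast+
    then show "w \<in> lists X - {[]}" by (simp add: w(1) plus_list_def)
  qed
  have "x - x * (u * x * u) * x = (x - x * u * x) + x * u * (x - x * u * x)"
    by (simp add: algebra_simps)
  then have "x - x * (u * x * u) * x \<in> H"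
    using H_add[OF d H_mult(1)[OF d xu]] by (simp only:)
  moreover have "coset x \<otimes>\<^bsub>Q\<^esub> coset (u * x * u) \<otimes>\<^bsub>Q\<^esub> coset x = coset (x * (u * x * u) * x)"
    using x z ideal.m_closed[of x "u * x * u"] by (simp add: Q_mult)
  ultimately show ?thesis
    using z H_uminus[of "x - x * (u * x * u) * x"]
    by (intro bexI[of _ "coset (u * x * u)"]) (auto simp: carrier_Q coset_eq_iff)
qed

end

definition word_degree :: "('g \<Rightarrow> int) \<Rightarrow> 'g list \<Rightarrow> int" where
  "word_degree deg w = sum_list (map deg w)"

lemma word_degree_plus: "word_degree deg (u + v) = word_degree deg u + word_degree deg v"
  by (simp add: word_degree_def plus_list_def)

definition homogeneous :: "('g \<Rightarrow> int) \<Rightarrow> int \<Rightarrow> ('g list \<Rightarrow>\<^sub>0 'k::zero) \<Rightarrow> bool" where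
  "homogeneous deg n f \<longleftrightarrow> Poly_Mapping.keys f \<subseteq> {w. word_degree deg w = n}"

locale graded_presentation =
  fixes X :: "'g set" and Rel :: "('g list \<Rightarrow>\<^sub>0 'k::field) set" and deg :: "'g \<Rightarrow> int"
  assumes Rel_carrier: "Rel \<subseteq> carrier (free_algebra X)"
    and Rel_homogeneous: "r \<in> Rel \<Longrightarrow> \<exists>n. homogeneous deg n r"
begin

abbreviation H where "H \<equiv> algebra_ideal (free_algebra X) hull Rel"

sublocale free_ideal X H
  by (unfold_locales, rule algebra_ideal_hull[OF Rel_carrier])

lemma Rel_H: "Rel \<subseteq> H"
  by (rule hull_subset)

abbreviation part :: "int \<Rightarrow> ('g list \<Rightarrow>\<^sub>0 'k) \<Rightarrow> 'g list \<Rightarrow>\<^sub>0 'k" where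
  "part n \<equiv> restrict_keys {w. word_degree deg w = n}"

lemma part_carrier: "x \<in> carrier F \<Longrightarrow> part n x \<in> carrier F"
  by (auto simp: carrier_free_algebra keys_restrict_keys)

lemma part_part: "part m (part n x) = (if m = n then part n x else 0)"
  by (auto simp: restrict_keys_restrict_keys intro!: restrict_keys_eq_zero)

lemma part_mult_part:
  "part n (part m x * y) = part m x * part (n - m) y"
  "part n (x * part m y) = part (n - m) x * part m y"
proof -
  have "part n (part m x * y) = restrict_keys UNIV (part m x) * part (n - m) y"
    by (rule restrict_keys_mult) (auto simp: keys_restrict_keys word_degree_plus)
  then show "part n (part m x * y) = part m x * part (n - m) y"
    by (simp add: restrict_keys_restrict_keys)
  have "part n (x * part m y) = part (n - m) x * restrict_keys UNIV (part m y)"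
    by (rule restrict_keys_mult) (auto simp: keys_restrict_keys word_degree_plus)
  then show "part n (x * part m y) = part (n - m) x * part m y"
    by (simp add: restrict_keys_restrict_keys)
qed

lemma sum_part: "(\<Sum>n\<in>word_degree deg ` Poly_Mapping.keys x. part n x) = x"
  by (rule poly_mapping_sum_restrict_keys) auto

text \<open>
  The ideal generated by homogeneous relations is graded: the elements all of whose components lie
  in the ideal again form an algebra ideal that contains the relations.
\<close>

lemma part_H: 
  assumes "x \<in> H" shows "part n x \<in> H"
proof -
  let ?I = "{x \<in> carrier F. \<forall>n. part n x \<in> H}"
  have "algebra_ideal F ?I"
  proof (rule algebra_ideal_freeI)
    show "?I \<subseteq> carrier F" "0 \<in> ?I" by (auto simp: H_zero carrier_free_algebra)
    show "x + y \<in> ?I" if "x \<in> ?I" "y \<in> ?I" for x y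
      using that ideal.add.m_closed[of x y] by (simp add: restrict_keys_add H_add)
    show "Poly_Mapping.single 0 c * x \<in> ?I" if "x \<in> ?I" for c x
    proof -
      have "part n (Poly_Mapping.single 0 c * x) = Poly_Mapping.single 0 c * part n x" for n
      proof -
        have "part n (Poly_Mapping.single 0 c * x)
            = restrict_keys UNIV (Poly_Mapping.single 0 c) * part n x"
          by (rule restrict_keys_mult) (auto simp: word_degree_def zero_list_def plus_list_def split: if_splits)
        then show ?thesis by (simp add: restrict_keys_eq_self)
      qed
      moreover have "Poly_Mapping.single 0 c * x \<in> carrier F"
        using free_ideal.H_scale[OF free_ideal.intro[OF algebra_ideal_carrier]] that by blast
      ultimately show ?thesis using that H_scale by simp
    qed
    fix x y assume x: "x \<in> ?I" and y: "y \<in> carrier F"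
    let ?D = "word_degree deg ` Poly_Mapping.keys y"
    have yp: "Poly_Mapping.keys (part m y) \<subseteq> lists X" for m
      using y by (auto simp: carrier_free_algebra keys_restrict_keys)
    have "part n (y * x) \<in> H" for n
    proof -
      have "part n (y * x) = part n ((\<Sum>m\<in>?D. part m y) * x)" by (simp only: sum_part)
      also have "\<dots> = (\<Sum>m\<in>?D. part m y * part (n - m) x)"
        by (simp add: sum_distrib_right restrict_keys_sum part_mult_part)
      also have "\<dots> \<in> H" using x yp by (intro H_sum H_mult) auto
      finally show ?thesis .
    qed
    then show "y * x \<in> ?I" using x y ideal.m_closed[of y x] by simp
    have "part n (x * y) \<in> H" for n
    proof -
      have "part n (x * y) = part n (x * (\<Sum>m\<in>?D. part m y))" by (simp only: sum_part)
      also have "\<dots> = (\<Sum>m\<in>?D. part (n - m) x * part m y)"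
        by (simp add: sum_distrib_left restrict_keys_sum part_mult_part)
      also have "\<dots> \<in> H" using x yp by (intro H_sum H_mult) auto
      finally show ?thesis .
    qed
    then show "x * y \<in> ?I" using x y ideal.m_closed[of x y] by simp
  qed
  moreover have "Rel \<subseteq> ?I"
  proof
    fix r assume r: "r \<in> Rel"
    then obtain m where m: "homogeneous deg m r" using Rel_homogeneous by blast
    have "part n r = (if n = m then r else 0)" for n
      using m by (auto simp: homogeneous_def intro!: restrict_keys_eq_self restrict_keys_eq_zero)
    then show "r \<in> ?I" using r Rel_H Rel_carrier H_zero by auto
  qed
  ultimately have "H \<subseteq> ?I" by (rule hull_minimal[rotated])
  then show ?thesis using assms by auto
qed

text \<open>
  The union runs over all representatives, which give the same coset as the ideal is graded.
\<close>

definition comp :: "int \<Rightarrow> ('g list \<Rightarrow>\<^sub>0 'k) set \<Rightarrow> ('g list \<Rightarrow>\<^sub>0 'k) set" where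
  "comp n Y = (\<Union>x\<in>Y. coset (part n x))"

lemma comp_coset: "comp n (coset x) = coset (part n x)"
proof -
  have "coset (part n y) = coset (part n x)" if "y \<in> coset x" for y
    using part_H[of "y - x" n] that by (simp add: coset_eq_iff mem_coset restrict_keys_diff)
  moreover have "x \<in> coset x" using H_zero by (simp add: mem_coset)
  ultimately show ?thesis unfolding comp_def by blast
qed

sublocale graded: Z_graded_ring Q comp
proof -
  interpret Q: nonunital_ring Q by (rule nonunital_ring_quotient[OF H])
  note simps = carrier_Q comp_coset Q_add Q_mult Q_zero part_carrier ideal.m_closed[simplified]
    ideal.add.m_closed[simplified]
  show "Z_graded_ring Q comp"
  proof unfold_locales
    fix x :: "('g list \<Rightarrow>\<^sub>0 'k) set" and m n :: int assume "x \<in> carrier Q"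
    then obtain f where f: "f \<in> carrier F" "x = coset f" by (auto simp: carrier_Q)
    show "comp n x \<in> carrier Q" using f by (simp add: simps)
    show "comp m (comp n x) = (if m = n then comp n x else \<zero>\<^bsub>Q\<^esub>)"
      using f by (simp add: simps part_part)
    have "{n. comp n x \<noteq> \<zero>\<^bsub>Q\<^esub>} \<subseteq> word_degree deg ` Poly_Mapping.keys f"
    proof (rule subsetI, rule ccontr)
      fix n assume n: "n \<in> {n. comp n x \<noteq> \<zero>\<^bsub>Q\<^esub>}" "n \<notin> word_degree deg ` Poly_Mapping.keys f"
      then have "part n f = 0" by (intro restrict_keys_eq_zero) auto
      then show False using n f by (simp add: simps)
    qed
    then show "finite {n. comp n x \<noteq> \<zero>\<^bsub>Q\<^esub>}" by (rule finite_subset) simp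
    assume "\<And>n. comp n x = \<zero>\<^bsub>Q\<^esub>"
    then have "part n f \<in> H" for n using f by (simp add: simps coset_eq_iff)
    then have "f \<in> H" using H_sum sum_part by metis
    then show "x = \<zero>\<^bsub>Q\<^esub>" using f by (simp add: simps coset_eq_iff)
  next
    fix x y :: "('g list \<Rightarrow>\<^sub>0 'k) set" and m n :: int
    assume "x \<in> carrier Q" "y \<in> carrier Q"
    then obtain f g where f: "f \<in> carrier F" "x = coset f" "g \<in> carrier F" "y = coset g"
      by (auto simp: carrier_Q)
    show "comp n (x \<oplus>\<^bsub>Q\<^esub> y) = comp n x \<oplus>\<^bsub>Q\<^esub> comp n y"
      using f by (simp add: simps restrict_keys_add)
    show "comp n (comp m x \<otimes>\<^bsub>Q\<^esub> y) = comp m x \<otimes>\<^bsub>Q\<^esub> comp (n - m) y"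
      "comp n (x \<otimes>\<^bsub>Q\<^esub> comp m y) = comp (n - m) x \<otimes>\<^bsub>Q\<^esub> comp m y"
      using f by (simp_all add: simps part_mult_part)
  qed
qed

theorem semiprimitive_presented_algebra:
  assumes "\<And>n x. x \<in> carrier F \<Longrightarrow> homogeneous deg n x \<Longrightarrow> \<exists>y. x - x * y * x \<in> H_ext"
  shows "semiprimitive (presented_algebra X Rel)"
proof -
  have "semiprimitive Q"
  proof (rule graded.semiprimitive_if_homogeneous_regular)
    fix n x assume "x \<in> carrier Q" "comp n x = x"
    then obtain f where f: "f \<in> carrier F" "x = coset (part n f)"
      by (auto simp: carrier_Q comp_coset)
    have "homogeneous deg n (part n f)" by (auto simp: homogeneous_def keys_restrict_keys)
    then show "\<exists>y\<in>carrier Q. x \<otimes>\<^bsub>Q\<^esub> y \<otimes>\<^bsub>Q\<^esub> x = x"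
      using assms[OF part_carrier[OF f(1)]] regular_coset part_carrier[OF f(1)] f(2) by blast
  qed
  then show ?thesis by (simp add: presented_algebra_def)
qed

end

section \<open>Homogeneous elements are regular\<close>

text \<open>
  A family of elements that satisfies, modulo \<open>H\<close>, the multiplication rules which bring words in
  the generators to the form \<open>s\<^sub>\<alpha> p\<^sub>A s\<^sub>\<beta>\<^sup>*\<close>; here \<open>t a\<close> is \<open>s\<^sub>a\<^sup>*\<close> and \<open>\<kappa>\<close> embeds the scalars.
\<close>

locale labelled_path_family =
  normal_labelled_space E lab alphabet \<B> + ring_ideal H
  for E :: "('v, 'e) pre_digraph" and lab :: "'e \<Rightarrow> 'l" and alphabet :: "'l set"
    and \<B> :: "'v set set" and H :: "'a::ring_1 set" +
  fixes \<kappa> :: "'k::field \<Rightarrow> 'a" and p :: "'v set \<Rightarrow> 'a" and s t :: "'l \<Rightarrow> 'a"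
  assumes \<kappa>_add: "\<kappa> (c + d) = \<kappa> c + \<kappa> d"
    and \<kappa>_mult: "\<kappa> (c * d) = \<kappa> c * \<kappa> d"
    and \<kappa>_one: "\<kappa> 1 = 1"
    and \<kappa>_central: "\<kappa> c * x = x * \<kappa> c"
    and p_inter: "A \<in> \<B> \<Longrightarrow> B \<in> \<B> \<Longrightarrow> p (A \<inter> B) \<approx> p A * p B"
    and p_union: "A \<in> \<B> \<Longrightarrow> B \<in> \<B> \<Longrightarrow> p (A \<union> B) \<approx> p A + p B - p (A \<inter> B)"
    and p_empty: "p {} \<approx> 0"
    and ps: "A \<in> \<B> \<Longrightarrow> a \<in> alphabet \<Longrightarrow> p A * s a \<approx> s a * p (rel_range E lab A [a])"
    and tp: "A \<in> \<B> \<Longrightarrow> a \<in> alphabet \<Longrightarrow> t a * p A \<approx> p (rel_range E lab A [a]) * t a"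
    and ts: "a \<in> alphabet \<Longrightarrow> t a * s a \<approx> p (rel_range E lab (verts E) [a])"
    and ts_neq: "a \<in> alphabet \<Longrightarrow> b \<in> alphabet \<Longrightarrow> b \<noteq> a \<Longrightarrow> t b * s a \<approx> 0"
    and sts: "a \<in> alphabet \<Longrightarrow> s a * t a * s a \<approx> s a"
    and tst: "a \<in> alphabet \<Longrightarrow> t a * s a * t a \<approx> t a"
begin

lemma \<kappa>_zero: "\<kappa> 0 = 0"
  using \<kappa>_add[of 0 0] by simp

lemma range_in:
  assumes "a \<in> alphabet" shows "rel_range E lab (verts E) [a] \<in> \<B>"
  using range_closed[OF letter_in] assms by blast

lemma rel_range_in:
  assumes "A \<in> \<B>" "a \<in> alphabet" shows "rel_range E lab A [a] \<in> \<B>"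
  using rel_range_closed letter_in assms by (auto simp: labelled_paths_def)

text \<open>
  \<open>level m n\<close> is the span of the terms \<open>s\<^sub>\<alpha> p\<^sub>A s\<^sub>\<beta>\<^sup>*\<close> with \<open>|\<alpha>| = m - j\<close> and \<open>|\<beta>| = n - j\<close> for some \<open>j\<close>,
  closed under congruence.  The levels with \<open>m - n = d\<close> increase with \<open>n\<close> and exhaust the
  degree \<open>d\<close> part of the subalgebra generated by the family, and \<open>n\<close> is the induction parameter
  for regularity.  The inductive form makes rule induction replace computations with normal forms.
\<close>

inductive level :: "nat \<Rightarrow> nat \<Rightarrow> 'a \<Rightarrow> bool" where
  level_p: "A \<in> \<B> \<Longrightarrow> level 0 0 (p A)"
| level_s: "level m n x \<Longrightarrow> a \<in> alphabet \<Longrightarrow> level (Suc m) n (s a * x)"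
| level_t: "level m n x \<Longrightarrow> b \<in> alphabet \<Longrightarrow> level m (Suc n) (x * t b)"
| level_shift: "level m n x \<Longrightarrow> level (Suc m) (Suc n) x"
| level_zero: "level m n 0"
| level_add: "level m n x \<Longrightarrow> level m n y \<Longrightarrow> level m n (x + y)"
| level_scale: "level m n x \<Longrightarrow> level m n (\<kappa> c * x)"
| level_congr: "level m n x \<Longrightarrow> x \<approx> y \<Longrightarrow> level m n y"

lemma level_diff: "level m n x \<Longrightarrow> level m n y \<Longrightarrow> level m n (x - y)"
proof -
  assume "level m n x" "level m n y"
  moreover have "\<kappa> (- 1) = - 1"
    using \<kappa>_add[of 1 "- 1"] by (simp add: \<kappa>_zero \<kappa>_one add_eq_0_iff2 minus_equation_iff)
  ultimately show ?thesis
    using level_add[of m n x "\<kappa> (- 1) * y"] level_scale[of m n y "- 1"] by simp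
qed

lemma level_p_left: "level m n x \<Longrightarrow> A \<in> \<B> \<Longrightarrow> level m n (p A * x)"
proof (induction arbitrary: A rule: level.induct)
  case (level_p B) then show ?case
    using level.level_congr[OF level.level_p[OF Int_closed] p_inter] by blast
next
  case (level_s m n x a)
  have "level (Suc m) n (s a * (p (rel_range E lab A [a]) * x))"
    using level_s rel_range_in by (intro level.level_s) auto
  moreover have "s a * (p (rel_range E lab A [a]) * x) \<approx> p A * (s a * x)"
    using congr_mult[OF congr_sym[OF ps] congr_refl] level_s by (metis mult.assoc)
  ultimately show ?case by (rule level.level_congr)
next
  case (level_t m n x b) then show ?case using level.level_t by (simp flip: mult.assoc)
next
  case (level_scale m n x c)
  have "p A * (\<kappa> c * x) = \<kappa> c * (p A * x)" by (metis \<kappa>_central mult.assoc)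
  then show ?case using level_scale level.level_scale by simp
next
  case (level_congr m n x y) then show ?case using level.level_congr congr_mult congr_refl by blast
qed (auto intro: level_p level_shift level_zero level_add simp: distrib_left)

lemma level_p_right: "level m n x \<Longrightarrow> A \<in> \<B> \<Longrightarrow> level m n (x * p A)"
proof (induction arbitrary: A rule: level.induct)
  case (level_p B) then show ?case
    using level.level_congr[OF level.level_p[OF Int_closed] p_inter] by blast
next
  case (level_t m n x a)
  have "level m (Suc n) (x * p (rel_range E lab A [a]) * t a)"
    using level_t rel_range_in by (intro level.level_t) auto
  moreover have "x * p (rel_range E lab A [a]) * t a \<approx> x * t a * p A"
    using congr_mult[OF congr_refl congr_sym[OF tp]] level_t by (metis mult.assoc)
  ultimately show ?case by (rule level.level_congr)
next
  case (level_s m n x b) then show ?case using level.level_s by (simp add: mult.assoc)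
next
  case (level_scale m n x c)
  then show ?case using level.level_scale by (simp add: mult.assoc)
next
  case (level_congr m n x y) then show ?case using level.level_congr congr_mult congr_refl by blast
qed (auto intro: level_p level_shift level_zero level_add simp: distrib_right)

lemma level_letter:
  assumes "a \<in> alphabet" shows "level (Suc 0) 0 (s a)" "level 0 (Suc 0) (t a)"
proof -
  have "s a * p (rel_range E lab (verts E) [a]) \<approx> s a * (t a * s a)"
    by (intro congr_mult congr_refl congr_sym[OF ts] assms)
  also have "\<dots> \<approx> s a" using sts assms by (simp add: mult.assoc)
  finally show "level (Suc 0) 0 (s a)" using level_s[OF level_p] range_in assms level_congr by blast
  have "p (rel_range E lab (verts E) [a]) * t a \<approx> t a * s a * t a"
    by (intro congr_mult congr_refl congr_sym[OF ts] assms)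
  also have "\<dots> \<approx> t a" using tst assms by (simp add: mult.assoc)
  finally show "level 0 (Suc 0) (t a)" using level_t[OF level_p] range_in assms level_congr by blast
qed

text \<open>
  Multiplication by \<open>t a\<close> on the left removes a letter from \<open>\<alpha>\<close> if there is one, and otherwise
  moves past \<open>p\<^sub>A\<close> and lengthens \<open>\<beta>\<close>.
\<close>

lemma level_t_left: 
  "level m n x \<Longrightarrow> a \<in> alphabet \<Longrightarrow> level (m - 1) (if m = 0 then Suc n else n) (t a * x)"
proof (induction rule: level.induct)
  case (level_p A)
  then show ?case
    using level_congr[OF level_p_left[OF level_letter(2) rel_range_in] congr_sym[OF tp]] by simp
next
  case (level_s m n x b)
  show ?case
  proof (cases "a = b")
    case True
    have "p (rel_range E lab (verts E) [a]) * x \<approx> t a * s a * x"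
      by (intro congr_mult congr_refl congr_sym[OF ts] level_s)
    then show ?thesis
      using level_congr[OF level_p_left[OF level_s(1) range_in]] level_s True by (simp add: mult.assoc)
  next
    case False
    have "t a * s b * x \<approx> 0 * x" using False level_s by (intro congr_mult congr_refl ts_neq) auto
    then show ?thesis using level_congr[OF level_zero congr_sym] by (simp add: mult.assoc)
  qed
next
  case (level_t m n x b) then show ?case using level.level_t by (auto simp flip: mult.assoc)
next
  case (level_shift m n x)
  from level.level_shift[OF level_shift.IH[OF level_shift.prems]] level_shift.IH[OF level_shift.prems]
  show ?case by (auto split: if_splits)
next
  case (level_scale m n x c)
  have "t a * (\<kappa> c * x) = \<kappa> c * (t a * x)" by (metis \<kappa>_central mult.assoc)
  then show ?case using level_scale level.level_scale by simp
next
  case (level_congr m n x y) then show ?case using level.level_congr congr_mult congr_refl by blast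
qed (auto intro: level_p level_shift level_zero level_add simp: distrib_left)

lemma level_s_right: 
  "level m n x \<Longrightarrow> a \<in> alphabet \<Longrightarrow> level (if n = 0 then Suc m else m) (n - 1) (x * s a)"
proof (induction rule: level.induct)
  case (level_p A)
  then show ?case
    using level_congr[OF level_p_right[OF level_letter(1) rel_range_in] congr_sym[OF ps]] by simp
next
  case (level_t m n x b)
  show ?case
  proof (cases "a = b")
    case True
    have "x * p (rel_range E lab (verts E) [a]) \<approx> x * (t a * s a)"
      by (intro congr_mult congr_refl congr_sym[OF ts] level_t)
    then show ?thesis
      using level_congr[OF level_p_right[OF level_t(1) range_in]] level_t True by (simp add: mult.assoc)
  next
    case False
    have "x * (t b * s a) \<approx> x * 0" using False level_t by (intro congr_mult congr_refl ts_neq) auto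
    then show ?thesis using level_congr[OF level_zero congr_sym] by (simp add: mult.assoc)
  qed
next
  case (level_s m n x b) then show ?case using level.level_s by (auto simp: mult.assoc)
next
  case (level_shift m n x)
  from level.level_shift[OF level_shift.IH[OF level_shift.prems]] level_shift.IH[OF level_shift.prems]
  show ?case by (auto split: if_splits)
next
  case (level_scale m n x c)
  then show ?case using level.level_scale by (simp add: mult.assoc)
next
  case (level_congr m n x y) then show ?case using level.level_congr congr_mult congr_refl by blast
qed (auto intro: level_p level_shift level_zero level_add simp: distrib_right)

text \<open>
  The shift \<open>k\<close> is what makes the induction go through: the factor \<open>x\<close> may sit in a lower level
  than the one in which the product is computed.
\<close>

lemma level_mult_shift: "level m n x \<Longrightarrow> level (n + k) l y \<Longrightarrow> level (m + k) l (x * y)"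
proof (induction arbitrary: k y rule: level.induct)
  case (level_p A) then show ?case by (simp add: level_p_left)
next
  case (level_s m n x a) then show ?case using level.level_s by (simp add: mult.assoc)
next
  case (level_t m n x b)
  then have "level (n + k) l (t b * y)" using level_t_left[of "Suc n + k" l y b] by simp
  then show ?case using level_t.IH by (simp add: mult.assoc)
next
  case (level_shift m n x) 
  then show ?case using level_shift.IH[of "Suc k" y] by simp
next
  case (level_scale m n x c) then show ?case using level.level_scale by (simp add: mult.assoc)
next
  case (level_congr m n x y) then show ?case using level.level_congr congr_mult congr_refl by blast
qed (auto intro: level_p level_shift level_zero level_add simp: distrib_right)

lemma level_mult: "level m n x \<Longrightarrow> level n l y \<Longrightarrow> level m l (x * y)"
  using level_mult_shift[of m n x 0] by simp

lemma level_shift_many: "level m n x \<Longrightarrow> level (m + k) (n + k) x"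
  by (induction k) (auto intro: level_shift)

text \<open>The projection onto the paths that begin with a letter of \<open>F\<close>.\<close>

definition proj :: "'l set \<Rightarrow> 'a" where "proj F = (\<Sum>a\<in>F. s a * t a)"

abbreviation letters :: "'l set \<Rightarrow> bool" where "letters F \<equiv> finite F \<and> F \<subseteq> alphabet"

lemma t_proj:
  assumes "letters F" "b \<in> F" shows "t b * proj F \<approx> t b"
proof -
  have "t b * proj F = (\<Sum>a\<in>F. t b * s a * t a)"
    by (simp add: proj_def sum_distrib_left mult.assoc)
  also have "\<dots> \<approx> (\<Sum>a\<in>F. if a = b then t b else 0)"
  proof (rule congr_sum)
    fix a assume "a \<in> F"
    then show "t b * s a * t a \<approx> (if a = b then t b else 0)"
      using assms tst[of b] congr_0_mult(1)[OF ts_neq, of a b "t a"]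
      by (cases "a = b") (auto dest: subsetD)
  qed
  finally show ?thesis using assms by simp
qed

lemma proj_s:
  assumes "letters F" "b \<in> F" shows "proj F * s b \<approx> s b"
proof -
  have "proj F * s b = (\<Sum>a\<in>F. s a * (t a * s b))"
    by (simp add: proj_def sum_distrib_right mult.assoc)
  also have "\<dots> \<approx> (\<Sum>a\<in>F. if a = b then s b else 0)"
  proof (rule congr_sum)
    fix a assume "a \<in> F"
    then show "s a * (t a * s b) \<approx> (if a = b then s b else 0)"
      using assms sts[of b] congr_0_mult(2)[OF ts_neq, of b a "s a"]
      by (cases "a = b") (auto dest: subsetD simp: mult.assoc)
  qed
  finally show ?thesis using assms by simp
qed

lemma proj_idem:
  assumes "letters F" shows "proj F * proj F \<approx> proj F"
proof -
  have "proj F * proj F = (\<Sum>a\<in>F. proj F * s a * t a)"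
    by (subst (2) proj_def) (simp add: sum_distrib_left mult.assoc)
  also have "\<dots> \<approx> proj F"
    unfolding proj_def[of F] using proj_s[OF assms, unfolded proj_def[of F]] 
    by (intro congr_sum congr_mult congr_refl) auto
  finally show ?thesis .
qed

lemma proj_p:
  assumes "letters F" "A \<in> \<B>" shows "proj F * p A \<approx> p A * proj F"
proof -
  have "proj F * p A = (\<Sum>a\<in>F. s a * (t a * p A))"
    by (simp add: proj_def sum_distrib_right mult.assoc)
  also have "\<dots> \<approx> (\<Sum>a\<in>F. p A * s a * t a)"
  proof (rule congr_sum)
    fix a assume "a \<in> F"
    then have a: "a \<in> alphabet" using assms by auto
    have "s a * (t a * p A) \<approx> s a * (p (rel_range E lab A [a]) * t a)"
      by (intro congr_mult congr_refl tp assms a)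
    also have "\<dots> = s a * p (rel_range E lab A [a]) * t a" by (simp add: mult.assoc)
    also have "\<dots> \<approx> p A * s a * t a"
      by (intro congr_mult congr_refl congr_sym[OF ps] assms a)
    finally show "s a * (t a * p A) \<approx> p A * s a * t a" .
  qed
  also have "\<dots> = p A * proj F" by (simp add: proj_def sum_distrib_left mult.assoc)
  finally show ?thesis .
qed

lemma level_proj: "letters F \<Longrightarrow> level (Suc n) (Suc n) (proj F)"
proof (induction F rule: infinite_finite_induct)
  case (insert a F)
  have "level (Suc 0) (Suc 0) (s a * t a)" using insert level_mult[OF level_letter] by auto
  then have "level (Suc n) (Suc n) (s a * t a)" using level_shift_many[of 1 1 _ n] by simp
  then show ?case using insert by (simp add: proj_def level_add)
qed (auto simp: proj_def level_zero)

lemma commutes_with_level_0_0: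
  assumes "\<And>A. A \<in> \<B> \<Longrightarrow> z * p A \<approx> p A * z" and "level 0 0 x"
  shows "z * x \<approx> x * z"
  using assms(2)
proof (induction "0::nat" "0::nat" x rule: level.induct)
  case (level_add x y)
  then show ?case using congr_add by (simp add: distrib_left distrib_right)
next
  case (level_scale x c)
  have "z * (\<kappa> c * x) = \<kappa> c * (z * x)" by (metis \<kappa>_central mult.assoc)
  also have "\<dots> \<approx> \<kappa> c * (x * z)" using level_scale by (intro congr_mult[OF congr_refl])
  finally show ?case by (simp add: mult.assoc)
next
  case (level_congr x y)
  have "z * y \<approx> z * x" using level_congr by (intro congr_mult congr_refl congr_sym[of x y])
  also have "\<dots> \<approx> x * z" by fact
  also have "\<dots> \<approx> y * z" using level_congr by (intro congr_mult congr_refl)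
  finally show ?case .
qed (auto intro: assms(1))

text \<open>
  The quasi-inverse is kept in the opposite level, so that the difference \<open>x - x y x\<close> of McCoy's
  lemma stays in the level of \<open>x\<close> and an induction over levels can continue with it.
\<close>

definition vn_regular :: "nat \<Rightarrow> nat \<Rightarrow> 'a \<Rightarrow> bool" where
  "vn_regular m n x \<longleftrightarrow> (\<exists>y. level n m y \<and> x * y * x \<approx> x)"

lemma vn_regular_congr:
  assumes "vn_regular m n x" "x \<approx> x'" shows "vn_regular m n x'"
proof -
  obtain y where y: "level n m y" "x * y * x \<approx> x" using assms by (auto simp: vn_regular_def)
  have "x' * y * x' \<approx> x * y * x" using assms congr_sym by (intro congr_mult) auto
  also note y(2)
  also note assms(2)
  finally show ?thesis using y(1) by (auto simp: vn_regular_def)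
qed

lemma vn_regular_0: "vn_regular m n 0"
  using level_zero by (auto simp: vn_regular_def)

lemma vn_regular_McCoy:
  assumes "level m n x" "level n m y" "vn_regular m n (x - x * y * x)"
  shows "vn_regular m n x"
proof -
  obtain w where w: "level n m w" "(x - x * y * x) * w * (x - x * y * x) \<approx> x - x * y * x"
    using assms by (auto simp: vn_regular_def)
  have "level n m (y + w - y * x * w - w * x * y + y * x * w * x * y)"
    using assms w by (intro level_add level_diff) (blast intro: level_mult)+
  then show ?thesis using McCoy_inner_inverse[OF w(2)] by (auto simp: vn_regular_def)
qed

definition step_sum :: "('k \<times> 'v set) list \<Rightarrow> 'a" where
  "step_sum xs = sum_list (map (\<lambda>(c, A). \<kappa> c * p A) xs)"

lemma level_0_0_step_sum:
  "level 0 0 x \<Longrightarrow> \<exists>xs. (snd ` set xs \<subseteq> \<B>) \<and> x \<approx> step_sum xs"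
proof (induction "0::nat" "0::nat" x rule: level.induct)
  case (level_p A)
  then show ?case by (intro exI[of _ "[(1, A)]"]) (simp add: step_sum_def \<kappa>_one)
next
  case level_zero
  then show ?case by (intro exI[of _ "[]"]) (simp add: step_sum_def)
next
  case (level_add x y)
  then obtain xs ys where "snd ` set xs \<subseteq> \<B>" "x \<approx> step_sum xs"
    "snd ` set ys \<subseteq> \<B>" "y \<approx> step_sum ys" by blast
  then show ?case
    by (intro exI[of _ "xs @ ys"]) (auto simp: step_sum_def intro: congr_add)
next
  case (level_scale x c)
  then obtain xs where xs: "snd ` set xs \<subseteq> \<B>" "x \<approx> step_sum xs" by blast
  have "\<kappa> c * x \<approx> \<kappa> c * step_sum xs" by (intro congr_mult congr_refl xs)
  also have "\<kappa> c * step_sum xs = step_sum (map (\<lambda>(d, A). (c * d, A)) xs)"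
    by (induction xs) (auto simp: step_sum_def distrib_left \<kappa>_mult mult.assoc)
  finally show ?case
    using xs(1) by (intro exI[of _ "map (\<lambda>(d, A). (c * d, A)) xs"]) auto
next
  case (level_congr x y)
  then show ?case using congr_trans[OF congr_sym[OF level_congr(3)]] by blast
qed

lemma level_step_sum: "snd ` set xs \<subseteq> \<B> \<Longrightarrow> level 0 0 (step_sum xs)"
  by (induction xs) (auto simp: step_sum_def intro!: level_zero level_add level_scale level_p)

lemma p_p_comm: 
  assumes "A \<in> \<B>" "B \<in> \<B>" shows "p A * p B \<approx> p B * p A"
  using congr_trans[OF congr_sym[OF p_inter] p_inter[of B A, simplified Int_commute[of B A]]] assms
  by blast

text \<open>
  Split \<open>A\<close> along the first set \<open>B\<close> of the list: on \<open>A \<inter> B\<close> its coefficient \<open>d\<close> joins the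
  constant \<open>c\<close>, on \<open>A - B\<close> it disappears, and the two orthogonal pieces have a shorter list.  The
  variable constant \<open>c\<close> is there for this induction.  Once the list is empty, the piece is a
  scalar multiple of an idempotent.
\<close>

lemma vn_regular_restricted_step_sum:
  assumes "snd ` set xs \<subseteq> \<B>" "A \<in> \<B>"
  shows "vn_regular 0 0 (p A * (\<kappa> c + step_sum xs))"
  using assms
proof (induction xs arbitrary: A c)
  case Nil
  show ?case
  proof (cases "c = 0")
    case True then show ?thesis by (simp add: step_sum_def \<kappa>_zero vn_regular_0)
  next
    case False
    have [simp]: "\<kappa> c * \<kappa> (inverse c) = 1" using False by (metis \<kappa>_mult \<kappa>_one right_inverse)
    have pp: "p A * p A \<approx> p A" using congr_sym[OF p_inter[of A A]] Nil by simp
    have "p A * \<kappa> c * (\<kappa> (inverse c) * p A) * (p A * \<kappa> c)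
        = p A * (\<kappa> c * \<kappa> (inverse c)) * p A * p A * \<kappa> c" by (simp only: mult.assoc)
    also have "\<dots> = p A * p A * p A * \<kappa> c" by simp
    also have "\<dots> \<approx> p A * p A * \<kappa> c" by (intro congr_mult congr_refl pp)
    also have "\<dots> \<approx> p A * \<kappa> c" by (intro congr_mult congr_refl pp)
    finally show ?thesis using level_scale[OF level_p] Nil
      by (auto simp: step_sum_def vn_regular_def)
  qed
next
  case (Cons cB xs)
  obtain d B where cB: "cB = (d, B)" by fastforce
  have B: "B \<in> \<B>" and xs: "snd ` set xs \<subseteq> \<B>" and A: "A \<in> \<B>"
    using Cons cB by auto
  let ?\<sigma> = "step_sum xs"
  define q q' where "q = p (A \<inter> B)" and "q' = p (A - B)"
  define u v where "u = q * (\<kappa> (c + d) + ?\<sigma>)" and "v = q' * (\<kappa> c + ?\<sigma>)"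
  have sets: "A \<inter> B \<in> \<B>" "A - B \<in> \<B>" using A B Int_closed Diff_closed by auto
  have idem: "q * q \<approx> q" "q' * q' \<approx> q'"
    unfolding q_def q'_def using congr_sym[OF p_inter] sets by (metis Int_absorb)+
  have orth: "q * q' \<approx> 0" "q' * q \<approx> 0"
  proof -
    have "A \<inter> B \<inter> (A - B) = {}" "(A - B) \<inter> (A \<inter> B) = {}" by auto
    then show "q * q' \<approx> 0" "q' * q \<approx> 0" unfolding q_def q'_def
      using congr_trans[OF congr_sym[OF p_inter] p_empty[THEN subst[rotated, where P = "\<lambda>x. p x \<approx> 0"]]]
        sets by metis+
  qed
  have comm: "x * p C \<approx> p C * x" if "level 0 0 x" "C \<in> \<B>" for x C
    using commutes_with_level_0_0[of "p C" x] p_p_comm that congr_sym by blast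
  have level_tail: "level 0 0 ?\<sigma>" by (rule level_step_sum[OF xs])
  have comm\<sigma>: "(\<kappa> k + ?\<sigma>) * p C \<approx> p C * (\<kappa> k + ?\<sigma>)" if "C \<in> \<B>" for k C
    using congr_add[OF congr_refl comm[OF level_tail that]] by (simp add: algebra_simps \<kappa>_central)
  have side: "r * (r * z) \<approx> r * z" "r * z * r \<approx> r * z"
    if "r * r \<approx> r" "z * r \<approx> r * z" for r z
  proof -
    show *: "r * (r * z) \<approx> r * z"
      using congr_mult[OF that(1) congr_refl] by (simp add: mult.assoc)
    have "r * z * r \<approx> r * (r * z)"
      using congr_mult[OF congr_refl that(2)] by (simp add: mult.assoc)
    also note *
    finally show "r * z * r \<approx> r * z" .
  qed
  have u: "q * u \<approx> u" "u * q \<approx> u"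
    unfolding u_def by (rule side[OF idem(1) comm\<sigma>[OF sets(1), folded q_def]])+
  have v: "q' * v \<approx> v" "v * q' \<approx> v"
    unfolding v_def by (rule side[OF idem(2) comm\<sigma>[OF sets(2), folded q'_def]])+
  obtain y y' where y: "level 0 0 y" "u * y * u \<approx> u" and y': "level 0 0 y'" "v * y' * v \<approx> v"
    using Cons.IH[OF xs sets(1)] Cons.IH[OF xs sets(2)]
    unfolding u_def v_def q_def q'_def vn_regular_def by blast
  have "level 0 0 (q * y * q + q' * y' * q')"
    unfolding q_def q'_def using sets y y' by (intro level_add level_p_left level_p_right) auto
  then have reg: "vn_regular 0 0 (u + v)"
    using orthogonal_sum[OF orth u y(2) v y'(2)] by (auto simp: vn_regular_def)
  have split: "p A \<approx> q + q'"
  proof -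
    have "(A \<inter> B) \<union> (A - B) = A" "(A \<inter> B) \<inter> (A - B) = {}" by auto
    then have "p A \<approx> q + q' - p {}"
      using p_union[OF sets] by (simp add: q_def q'_def)
    also have "\<dots> \<approx> q + q' - 0" by (intro congr_intros congr_refl p_empty)
    finally show ?thesis by simp
  qed
  have qB: "p A * p B \<approx> q" using congr_sym[OF p_inter] A B by (simp add: q_def)
  have "p A * (\<kappa> c + step_sum (cB # xs)) = p A * (\<kappa> c + ?\<sigma>) + \<kappa> d * (p A * p B)"
  proof -
    have "p A * (\<kappa> d * p B) = \<kappa> d * (p A * p B)" by (metis \<kappa>_central mult.assoc)
    then show ?thesis by (simp add: cB step_sum_def distrib_left add_ac)
  qed
  also have "\<dots> \<approx> (q + q') * (\<kappa> c + ?\<sigma>) + \<kappa> d * q"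
    by (intro congr_intros congr_refl split qB)
  also have "\<dots> = u + v"
    by (simp add: u_def v_def algebra_simps \<kappa>_add \<kappa>_central)
  finally show ?case using vn_regular_congr[OF reg] congr_sym by blast
qed

lemma p_absorb_step_sum:
  assumes "snd ` set xs \<subseteq> \<B>"
  shows "\<exists>A\<in>\<B>. p A * step_sum xs \<approx> step_sum xs"
proof -
  have "\<exists>A\<in>\<B>. \<forall>x\<in>set xs. snd x \<subseteq> A"
    using assms
  proof (induction xs)
    case Nil then show ?case using empty_in by auto
  next
    case (Cons x xs)
    then obtain A where A: "A \<in> \<B>" "\<forall>x\<in>set xs. snd x \<subseteq> A" by auto
    have "A \<union> snd x \<in> \<B>" using Cons.prems A Un_closed by auto
    moreover have "\<forall>y\<in>set (x # xs). snd y \<subseteq> A \<union> snd x" using A by auto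
    ultimately show ?case by blast
  qed
  then obtain A where A: "A \<in> \<B>" "\<forall>x\<in>set xs. snd x \<subseteq> A" by blast
  have "p A * step_sum xs \<approx> step_sum xs"
    using A(2) assms
  proof (induction xs)
    case (Cons x xs)
    obtain c B where x: "x = (c, B)" by fastforce
    have B: "B \<in> \<B>" "B \<subseteq> A" using Cons x by auto
    then have "p A * p B \<approx> p B" using congr_sym[OF p_inter] A(1) by (metis Int_absorb1)
    then have "\<kappa> c * (p A * p B) + p A * step_sum xs \<approx> \<kappa> c * p B + step_sum xs"
      using Cons by (intro congr_intros congr_refl) auto
    moreover have "p A * (\<kappa> c * p B) = \<kappa> c * (p A * p B)" by (metis \<kappa>_central mult.assoc)
    ultimately show ?case by (simp add: x step_sum_def distrib_left)
  qed (simp add: step_sum_def)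
  then show ?thesis using A(1) by blast
qed

lemma vn_regular_0_0:
  assumes "level 0 0 x" shows "vn_regular 0 0 x"
proof -
  obtain xs where xs: "snd ` set xs \<subseteq> \<B>" "x \<approx> step_sum xs"
    using level_0_0_step_sum[OF assms] by blast
  obtain A where A: "A \<in> \<B>" "p A * step_sum xs \<approx> step_sum xs"
    using p_absorb_step_sum[OF xs(1)] by blast
  have "vn_regular 0 0 (p A * (\<kappa> 0 + step_sum xs))"
    by (rule vn_regular_restricted_step_sum[OF xs(1) A(1)])
  then show ?thesis
    using vn_regular_congr A(2) congr_sym[OF xs(2)] by (metis \<kappa>_zero add_0)
qed

lemma proj_insert: "finite F \<Longrightarrow> a \<notin> F \<Longrightarrow> proj (insert a F) = s a * t a + proj F"
  by (simp add: proj_def)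

text \<open>
  \<open>EV F. P F\<close> says that \<open>P\<close> holds for all sufficiently large finite sets of letters, so that finitely
  many conditions on \<open>F\<close> can be imposed together.
\<close>

abbreviation eventually_letters :: "('l set \<Rightarrow> bool) \<Rightarrow> bool" (binder \<open>EV \<close> 10)
  where "EV F. P F \<equiv> eventually P (finite_subsets_at_top alphabet)"

lemma eventually_contains: 
  assumes "a \<in> alphabet" shows "EV F. letters F \<and> a \<in> F"
  unfolding eventually_finite_subsets_at_top using assms by (intro exI[of _ "{a}"]) auto

lemma eventually_letters_obtain:
  assumes "EV F. P F" obtains F where "letters F" "P F"
proof -
  have "EV F. letters F" by (rule eventually_finite_subsets_at_top_weakI) simp
  then have "EV F. letters F \<and> P F" using assms by (rule eventually_conj)
  from eventually_happens[OF this] show ?thesis using that by auto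
qed

lemma left_support:
  "level m n x \<Longrightarrow> n = 0 \<Longrightarrow> m \<noteq> 0 \<Longrightarrow> EV F. proj F * x \<approx> x"
proof (induction rule: level.induct)
  case (level_s m n x a)
  from eventually_contains[OF level_s.hyps(2)] show ?case
  proof eventually_elim
    case (elim F)
    then have "proj F * s a * x \<approx> s a * x" by (intro congr_mult[OF proj_s congr_refl]) auto
    then show ?case by (simp only: mult.assoc)
  qed
next
  case (level_add m n x y)
  from level_add.IH(1)[OF level_add.prems] level_add.IH(2)[OF level_add.prems] show ?case
    by eventually_elim (simp add: distrib_left congr_add)
next
  case (level_scale m n x c)
  from level_scale.IH[OF level_scale.prems] show ?case
  proof eventually_elim
    case (elim F)
    have "proj F * (\<kappa> c * x) = \<kappa> c * (proj F * x)" by (metis \<kappa>_central mult.assoc)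
    then show ?case using congr_mult[OF congr_refl elim] by simp
  qed
next
  case (level_congr m n x y)
  from level_congr.IH[OF level_congr.prems] show ?case
    by eventually_elim
      (blast intro: congr_trans[OF congr_mult[OF congr_refl congr_sym[OF level_congr(2)]]]
        congr_trans[OF _ level_congr(2)])
qed auto

text \<open>
  The rows \<open>s\<^sub>a (s\<^sub>a\<^sup>* x)\<close> of \<open>x\<close> are removed one by one: a quasi-inverse \<open>y\<close> of \<open>s\<^sub>a\<^sup>* x\<close>
  gives \<open>y s\<^sub>a\<^sup>*\<close>, for which the row \<open>a\<close> of \<open>x - x (y s\<^sub>a\<^sup>*) x\<close> is zero, and McCoy's lemma passes
  from the difference back to \<open>x\<close>.
\<close>

lemma vn_regular_left_support:
  assumes "letters F" "level (Suc m) 0 x" "proj F * x \<approx> x"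
    and IH: "\<And>z. level m 0 z \<Longrightarrow> vn_regular m 0 z"
  shows "vn_regular (Suc m) 0 x"
proof -
  have "finite F" using assms by simp
  then show ?thesis using assms(1-3)
  proof (induction F arbitrary: x rule: finite_induct)
    case empty
    then show ?case using vn_regular_congr[OF vn_regular_0] by (simp add: proj_def)
  next
    case (insert a F)
    have a: "a \<in> alphabet" using insert by auto
    let ?w = "t a * x"
    have "level m 0 ?w" using level_t_left[of "Suc m" 0 x a] insert a by simp
    then obtain y where y: "level 0 m y" "?w * y * ?w \<approx> ?w" using IH by (auto simp: vn_regular_def)
    have y': "level 0 (Suc m) (y * t a)" by (rule level_t[OF y(1) a])
    let ?z = "x - x * (y * t a) * x"
    have z: "level (Suc m) 0 ?z"
      by (rule level_diff[OF insert.prems(2) level_mult[OF level_mult[OF insert.prems(2) y'] insert.prems(2)]])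
    have proj_z: "proj (insert a F) * ?z \<approx> ?z"
    proof -
      have "proj (insert a F) * ?z = proj (insert a F) * x - proj (insert a F) * x * (y * t a) * x"
        by (simp add: algebra_simps)
      also have "\<dots> \<approx> ?z" by (intro congr_intros congr_refl insert.prems)
      finally show ?thesis .
    qed
    have "s a * t a * ?z = s a * (?w - ?w * y * ?w)" by (simp add: algebra_simps)
    also have "\<dots> \<approx> s a * (?w - ?w)" by (intro congr_intros congr_refl y)
    finally have sa_z: "s a * t a * ?z \<approx> 0" by simp
    have "proj F * ?z = proj (insert a F) * ?z - s a * t a * ?z"
      using insert by (simp add: proj_insert algebra_simps)
    also have "\<dots> \<approx> ?z - 0" by (intro congr_diff proj_z sa_z)
    finally have "proj F * ?z \<approx> ?z" by simp
    then have "vn_regular (Suc m) 0 ?z" using insert.IH z insert.prems by auto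
    then show ?case using vn_regular_McCoy insert.prems y' by blast
  qed
qed

lemma vn_regular_m_0: "level m 0 x \<Longrightarrow> vn_regular m 0 x"
proof (induction m arbitrary: x)
  case 0 then show ?case by (rule vn_regular_0_0)
next
  case (Suc m)
  obtain F where "letters F" "proj F * x \<approx> x"
    using eventually_letters_obtain[OF left_support[OF Suc.prems]] by blast
  then show ?case using vn_regular_left_support Suc by blast
qed

text \<open>
  The same elimination for the columns \<open>(x s\<^sub>b) s\<^sub>b\<^sup>*\<close>.
\<close>

lemma vn_regular_right_support:
  assumes "letters F" "level m (Suc n) x" "x * proj F \<approx> x"
    and IH: "\<And>z. level m n z \<Longrightarrow> vn_regular m n z"
  shows "vn_regular m (Suc n) x"
proof -
  have "finite F" using assms by simp
  then show ?thesis using assms(1-3)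
  proof (induction F arbitrary: x rule: finite_induct)
    case empty
    then show ?case using vn_regular_congr[OF vn_regular_0] by (simp add: proj_def)
  next
    case (insert b F)
    have b: "b \<in> alphabet" using insert by auto
    let ?w = "x * s b"
    have "level m n ?w" using level_s_right[of m "Suc n" x b] insert b by simp
    then obtain y where y: "level n m y" "?w * y * ?w \<approx> ?w" using IH by (auto simp: vn_regular_def)
    have y': "level (Suc n) m (s b * y)" by (rule level_s[OF y(1) b])
    let ?z = "x - x * (s b * y) * x"
    have z: "level m (Suc n) ?z"
      by (rule level_diff[OF insert.prems(2) level_mult[OF level_mult[OF insert.prems(2) y'] insert.prems(2)]])
    have z_proj: "?z * proj (insert b F) \<approx> ?z"
    proof -
      have "?z * proj (insert b F) = x * proj (insert b F) - x * (s b * y) * (x * proj (insert b F))"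
        by (simp add: algebra_simps)
      also have "\<dots> \<approx> ?z" by (intro congr_intros congr_refl insert.prems)
      finally show ?thesis .
    qed
    have "?z * (s b * t b) = (?w - ?w * y * ?w) * t b" by (simp add: algebra_simps)
    also have "\<dots> \<approx> (?w - ?w) * t b" by (intro congr_intros congr_refl y)
    finally have zb: "?z * (s b * t b) \<approx> 0" by simp
    have "?z * proj F = ?z * proj (insert b F) - ?z * (s b * t b)"
      using insert by (simp add: proj_insert algebra_simps)
    also have "\<dots> \<approx> ?z - 0" by (intro congr_diff z_proj zb)
    finally have "?z * proj F \<approx> ?z" by simp
    then have "vn_regular m (Suc n) ?z" using insert.IH z insert.prems by auto
    then show ?case using vn_regular_McCoy insert.prems y' by blast
  qed
qed

text \<open>
  Terms \<open>s\<^sub>\<alpha> p\<^sub>A s\<^sub>\<beta>\<^sup>*\<close> with nonempty \<open>\<beta>\<close> are killed by \<open>1 - proj F\<close> once \<open>F\<close> contains the first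
  letter of \<open>\<beta>\<close>.  What survives is the sum \<open>u\<close> of the terms with empty \<open>\<beta>\<close>, and there are none
  if \<open>m < n\<close>.
\<close>

lemma right_support:
  "level m n x \<Longrightarrow> \<exists>u. (if n \<le> m then level (m - n) 0 u else u = 0) \<and>
     (EV F. x * (1 - proj F) \<approx> u * (1 - proj F))"
proof (induction rule: level.induct)
  case (level_p A)
  then show ?case using level.level_p by (intro exI[of _ "p A"]) simp
next
  case (level_s m n x a)
  then obtain u where u: "if n \<le> m then level (m - n) 0 u else u = 0"
    and ev: "EV F. x * (1 - proj F) \<approx> u * (1 - proj F)" by blast
  have "if n \<le> Suc m then level (Suc m - n) 0 (s a * u) else s a * u = 0"
    using u level.level_s[OF _ level_s(2)] level_zero by (auto simp: Suc_diff_le not_less_eq_eq le_Suc_eq)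
  moreover from ev have "EV F. s a * x * (1 - proj F) \<approx> s a * u * (1 - proj F)"
    by eventually_elim (simp only: mult.assoc congr_mult congr_refl)
  ultimately show ?case by blast
next
  case (level_t m n x b)
  from eventually_contains[OF level_t.hyps(2)] have "EV F. x * t b * (1 - proj F) \<approx> 0 * (1 - proj F)"
  proof eventually_elim
    case (elim F)
    have "x * t b * (1 - proj F) = x * (t b - t b * proj F)" by (simp add: algebra_simps)
    also have "\<dots> \<approx> x * (t b - t b)" using elim by (intro congr_intros congr_refl t_proj) auto
    finally show ?case by simp
  qed
  moreover have "if Suc n \<le> m then level (m - Suc n) 0 0 else (0::'a) = 0" using level_zero by simp
  ultimately show ?case by blast
next
  case (level_shift m n x) then show ?case by (simp only: Suc_le_mono diff_Suc_Suc)
next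
  case (level_zero m n)
  show ?case using level.level_zero by (intro exI[of _ 0]) simp
next
  case (level_add m n x y)
  from level_add.IH(1) obtain u where u: "if n \<le> m then level (m - n) 0 u else u = 0"
    and evu: "EV F. x * (1 - proj F) \<approx> u * (1 - proj F)" by blast
  from level_add.IH(2) obtain v where v: "if n \<le> m then level (m - n) 0 v else v = 0"
    and evv: "EV F. y * (1 - proj F) \<approx> v * (1 - proj F)" by blast
  have "if n \<le> m then level (m - n) 0 (u + v) else u + v = 0"
    using u v level.level_add by simp
  moreover from evu evv have "EV F. (x + y) * (1 - proj F) \<approx> (u + v) * (1 - proj F)"
    by eventually_elim (simp add: distrib_right congr_add)
  ultimately show ?case by blast
next
  case (level_scale m n x c)
  then obtain u where u: "if n \<le> m then level (m - n) 0 u else u = 0"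
    and ev: "EV F. x * (1 - proj F) \<approx> u * (1 - proj F)" by blast
  have "if n \<le> m then level (m - n) 0 (\<kappa> c * u) else \<kappa> c * u = 0"
    using u level.level_scale by simp
  moreover from ev have "EV F. \<kappa> c * x * (1 - proj F) \<approx> \<kappa> c * u * (1 - proj F)"
    by eventually_elim (simp only: mult.assoc congr_mult congr_refl)
  ultimately show ?case by blast
next
  case (level_congr m n x y)
  then obtain u where u: "if n \<le> m then level (m - n) 0 u else u = 0"
    and ev: "EV F. x * (1 - proj F) \<approx> u * (1 - proj F)" by blast
  from ev have "EV F. y * (1 - proj F) \<approx> u * (1 - proj F)"
    by eventually_elim (rule congr_trans[OF congr_mult[OF congr_sym[OF level_congr(2)] congr_refl]])
  then show ?case using u by blast
qed

text \<open>
  First the part of \<open>x\<close> outside \<open>proj F\<close> is eliminated.  There \<open>x\<close> agrees with \<open>u\<close>, whose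
  quasi-inverse \<open>y\<close> can be used because \<open>y u\<close> has level \<open>(0, 0)\<close> and therefore commutes
  with \<open>1 - proj F\<close>.  The columns that remain have a smaller \<open>n\<close>.
\<close>

theorem level_regular: "level m n x \<Longrightarrow> vn_regular m n x"
proof (induction n arbitrary: m x)
  case 0 then show ?case by (rule vn_regular_m_0)
next
  case (Suc n)
  obtain u where u: "if Suc n \<le> m then level (m - Suc n) 0 u else u = 0"
    and ev: "EV F. x * (1 - proj F) \<approx> u * (1 - proj F)"
    using right_support[OF Suc.prems] by blast
  obtain F where F: "letters F" and xu: "x * (1 - proj F) \<approx> u * (1 - proj F)"
    using eventually_letters_obtain[OF ev] by blast
  define f where "f = 1 - proj F"
  obtain y where y: "level (Suc n) m y" "u * y * u \<approx> u" "level 0 0 (y * u)"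
  proof (cases "Suc n \<le> m")
    case True
    then obtain y where "level 0 (m - Suc n) y" "u * y * u \<approx> u"
      using u vn_regular_m_0 by (auto simp: vn_regular_def)
    then show ?thesis
      using that[of y] level_shift_many[of 0 "m - Suc n" y "Suc n"] level_mult[of 0 _ y 0 u] u True by simp
  next
    case False then show ?thesis using that[of 0] u level_zero by simp
  qed
  have fy: "level (Suc n) m (f * y)"
    unfolding f_def left_diff_distrib mult_1 using y(1) level_diff level_mult[OF level_proj[OF F]] by blast
  have ff: "f * f \<approx> f"
  proof -
    have "f * f = 1 - proj F - proj F + proj F * proj F" by (simp add: f_def algebra_simps)
    also have "\<dots> \<approx> 1 - proj F - proj F + proj F" by (intro congr_intros congr_refl proj_idem F)
    finally show ?thesis by (simp add: f_def)
  qed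
  have comm: "f * (y * u) \<approx> y * u * f"
  proof (rule commutes_with_level_0_0[OF _ y(3)])
    fix A assume "A \<in> \<B>"
    then show "f * p A \<approx> p A * f"
      using congr_diff[OF congr_refl proj_p[OF F]] by (simp add: f_def algebra_simps)
  qed
  let ?z = "x - x * (f * y) * x"
  have "?z * f = x * f - (x * f) * y * (x * f)" by (simp add: algebra_simps)
  also have "\<dots> \<approx> u * f - (u * f) * y * (u * f)"
    unfolding f_def by (intro congr_intros congr_refl xu)
  also have "\<dots> = u * f - u * (f * (y * u)) * f" by (simp add: mult.assoc)
  also have "\<dots> \<approx> u * f - u * (y * u * f) * f" by (intro congr_intros congr_refl comm)
  also have "\<dots> = u * f - u * y * u * (f * f)" by (simp add: mult.assoc)
  also have "\<dots> \<approx> u * f - u * f" by (intro congr_intros congr_refl ff y)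
  finally have "?z * f \<approx> 0" by simp
  then have "?z - ?z * f \<approx> ?z - 0" by (rule congr_diff[OF congr_refl])
  then have z_projF: "?z * proj F \<approx> ?z" by (simp add: f_def right_diff_distrib)
  have "level m (Suc n) ?z"
    by (rule level_diff[OF Suc.prems level_mult[OF level_mult[OF Suc.prems fy] Suc.prems]])
  then have "vn_regular m (Suc n) ?z"
    using vn_regular_right_support[OF F _ z_projF] Suc.IH by blast
  then show ?case using vn_regular_McCoy Suc.prems fy by blast
qed

end

section \<open>Semiprimitivity of the Leavitt labelled path algebra\<close>

fun generator_degree :: "('v, 'l) generator \<Rightarrow> int" where
  "generator_degree (Gen_p A) = 0"
| "generator_degree (Gen_s a) = 1"
| "generator_degree (Gen_s_star a) = - 1"

lemma homogeneous_diff: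
  "homogeneous deg n f \<Longrightarrow> homogeneous deg n g \<Longrightarrow> homogeneous deg n (f - (g :: _ \<Rightarrow>\<^sub>0 'k::field))"
  unfolding homogeneous_def using keys_diff[of f g] by blast

lemma homogeneous_add:
  "homogeneous deg n f \<Longrightarrow> homogeneous deg n g \<Longrightarrow> homogeneous deg n (f + (g :: _ \<Rightarrow>\<^sub>0 'k::field))"
  unfolding homogeneous_def using Poly_Mapping.keys_add[of f g] by blast

lemma homogeneous_sum:
  "(\<And>i. i \<in> I \<Longrightarrow> homogeneous deg n (f i)) \<Longrightarrow> homogeneous deg n (\<Sum>i\<in>I. f i :: _ \<Rightarrow>\<^sub>0 'k::field)"
proof (induction I rule: infinite_finite_induct)
  case (insert i I)
  then have "homogeneous deg n (f i + sum f I)" by (intro homogeneous_add) auto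
  then show ?case using insert by simp
qed (simp_all add: homogeneous_def)

lemma homogeneous_times:
  "homogeneous deg m f \<Longrightarrow> homogeneous deg n g \<Longrightarrow> m + n = k \<Longrightarrow>
   homogeneous deg k (f * (g :: _ \<Rightarrow>\<^sub>0 'k::field))"
  unfolding homogeneous_def using keys_mult[of f g] by (fastforce simp: word_degree_plus)

lemma homogeneous_letter: "deg g = n \<Longrightarrow> homogeneous deg n (Poly_Mapping.single [g] (c::'k::field))"
  by (simp add: homogeneous_def word_degree_def)

text \<open>Each relation is a combination of products of generators whose degrees add up to the same value.\<close>

lemma leavitt_relations_homogeneous:
  fixes E :: "('v, 'e) pre_digraph" and lab :: "'e \<Rightarrow> 'l"
  assumes "r \<in> (leavitt_relations E lab alphabet \<B> :: (('v, 'l) generator list \<Rightarrow>\<^sub>0 'k::field) set)"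
  shows "\<exists>n. homogeneous generator_degree n r"
proof -
  have p: "homogeneous generator_degree 0 (p_elem A :: ('v, 'l) generator list \<Rightarrow>\<^sub>0 'k)" for A
    by (rule homogeneous_letter) simp
  have s: "homogeneous generator_degree 1 (s_elem a :: ('v, 'l) generator list \<Rightarrow>\<^sub>0 'k)" for a
    by (rule homogeneous_letter) simp
  have t: "homogeneous generator_degree (- 1) (s_star_elem a :: ('v, 'l) generator list \<Rightarrow>\<^sub>0 'k)" for a
    by (rule homogeneous_letter) simp
  note mult = homogeneous_times[where deg = generator_degree]
  note st = mult[OF s t refl, simplified] and ts = mult[OF t s refl, simplified]
    and pp = mult[OF p p refl, simplified] and ps = mult[OF p s refl, simplified]
    and sp = mult[OF s p refl, simplified] and tp = mult[OF t p refl, simplified]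
    and pt = mult[OF p t refl, simplified]
  note intros = homogeneous_diff homogeneous_add homogeneous_sum p s t st ts pp ps sp tp pt
    mult[OF st s refl, simplified] mult[OF ts t refl, simplified] mult[OF sp t refl, simplified]
  from assms show ?thesis
    by cases (simp only:, rule exI, (rule intros)+)+
qed

lemma mem_leavitt_generators:
  "Gen_p A \<in> leavitt_generators alphabet \<B> \<longleftrightarrow> A \<in> \<B>"
  "Gen_s a \<in> leavitt_generators alphabet \<B> \<longleftrightarrow> a \<in> alphabet"
  "Gen_s_star a \<in> leavitt_generators alphabet \<B> \<longleftrightarrow> a \<in> alphabet"
  by (auto simp: leavitt_generators_def)

context labelled_path_family
begin

text \<open>Two levels with the same \<open>m - n\<close> are contained in a common one, which makes this union a subspace.\<close>

definition homogeneous_element :: "int \<Rightarrow> 'a \<Rightarrow> bool" where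
  "homogeneous_element d x \<longleftrightarrow> (\<exists>m n. int m - int n = d \<and> level m n x)"

lemma homogeneous_element_zero: "homogeneous_element d 0"
  unfolding homogeneous_element_def
  by (intro exI[of _ "nat d"] exI[of _ "nat (- d)"]) (simp add: level_zero)

lemma homogeneous_element_add:
  assumes "homogeneous_element d x" "homogeneous_element d y"
  shows "homogeneous_element d (x + y)"
proof -
  obtain m n m' n' where x: "int m - int n = d" "level m n x" and y: "int m' - int n' = d" "level m' n' y"
    using assms by (auto simp: homogeneous_element_def)
  have "level (m + m') (n + m') x" "level (m' + m) (n' + m) y" using x y level_shift_many by auto
  moreover have "n + m' = n' + m" using x y by linarith
  ultimately have "level (m + m') (n + m') (x + y)" by (intro level_add) (simp_all add: add.commute)
  moreover have "int (m + m') - int (n + m') = d" using x by simp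
  ultimately show ?thesis unfolding homogeneous_element_def by blast
qed

lemma homogeneous_element_scale: "homogeneous_element d x \<Longrightarrow> homogeneous_element d (\<kappa> c * x)"
  unfolding homogeneous_element_def using level_scale by blast

lemma homogeneous_element_sum:
  "(\<And>i. i \<in> I \<Longrightarrow> homogeneous_element d (f i)) \<Longrightarrow> homogeneous_element d (sum f I)"
  by (induction I rule: infinite_finite_induct)
    (auto intro: homogeneous_element_add simp: homogeneous_element_zero)

lemma homogeneous_element_p:
  "A \<in> \<B> \<Longrightarrow> homogeneous_element 0 (p A)"
  "A \<in> \<B> \<Longrightarrow> homogeneous_element d x \<Longrightarrow> homogeneous_element d (p A * x)"
  using level_p level_p_left by (fastforce simp: homogeneous_element_def)+

lemma homogeneous_element_s:
  assumes "a \<in> alphabet"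
  shows "homogeneous_element 1 (s a)"
    and "homogeneous_element d x \<Longrightarrow> homogeneous_element (1 + d) (s a * x)"
proof -
  show "homogeneous_element 1 (s a)"
    unfolding homogeneous_element_def
    by (intro exI[of _ 1] exI[of _ 0]) (simp add: level_letter assms)
  assume "homogeneous_element d x"
  then obtain m n where "int m - int n = d" "level m n x" by (auto simp: homogeneous_element_def)
  then show "homogeneous_element (1 + d) (s a * x)"
    using level_s assms unfolding homogeneous_element_def
    by (intro exI[of _ "Suc m"] exI[of _ n]) auto
qed

lemma homogeneous_element_t:
  assumes "a \<in> alphabet"
  shows "homogeneous_element (- 1) (t a)"
    and "homogeneous_element d x \<Longrightarrow> homogeneous_element (d - 1) (t a * x)"
proof -
  show "homogeneous_element (- 1) (t a)"
    unfolding homogeneous_element_def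
    by (intro exI[of _ 0] exI[of _ 1]) (simp add: level_letter assms)
  assume "homogeneous_element d x"
  then obtain m n where "int m - int n = d" "level m n x" by (auto simp: homogeneous_element_def)
  then show "homogeneous_element (d - 1) (t a * x)"
    using level_t_left[OF _ assms] unfolding homogeneous_element_def
    by (intro exI[of _ "m - 1"] exI[of _ "if m = 0 then Suc n else n"]) auto
qed

lemma homogeneous_element_regular:
  assumes "homogeneous_element d x" shows "\<exists>y. x * y * x \<approx> x"
  using assms level_regular unfolding homogeneous_element_def vn_regular_def by blast

end

context normal_labelled_space
begin

theorem semiprimitive_leavitt:
  "semiprimitive (leavitt_labelled_path_algebra TYPE('k::field) E lab alphabet \<B>)"
proof -
  let ?X = "leavitt_generators alphabet \<B>"
  let ?Rel = "leavitt_relations E lab alphabet \<B> :: (('v, 'l) generator list \<Rightarrow>\<^sub>0 'k) set"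
  interpret L: graded_presentation ?X ?Rel generator_degree
    using leavitt_relations_subset leavitt_relations_homogeneous by unfold_locales
  interpret ideal: ring_ideal L.H_ext by (rule L.H_ext)
  have rel: "r \<in> L.H_ext" if "r \<in> ?Rel" for r
    using that L.Rel_H L.H_subset_H_ext by blast
  note congr = ideal.congr_def
  interpret family: labelled_path_family E lab alphabet \<B> L.H_ext "Poly_Mapping.single 0"
    p_elem s_elem s_star_elem
  proof unfold_locales
    fix A B assume AB: "A \<in> \<B>" "B \<in> \<B>"
    show "ideal.congr (p_elem (A \<inter> B)) (p_elem A * p_elem B)"
      "ideal.congr (p_elem (A \<union> B)) (p_elem A + p_elem B - p_elem (A \<inter> B))"
      unfolding congr by (rule rel, rule leavitt_relations.p_Int leavitt_relations.p_Un, fact AB, fact AB)+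
  next
    show "ideal.congr (p_elem {}) 0"
      unfolding congr using rel[OF leavitt_relations.p_empty] by simp
  next
    fix A a assume Aa: "A \<in> \<B>" "a \<in> alphabet"
    show "ideal.congr (p_elem A * s_elem a) (s_elem a * p_elem (rel_range E lab A [a]))"
      "ideal.congr (s_star_elem a * p_elem A) (p_elem (rel_range E lab A [a]) * s_star_elem a)"
      unfolding congr by (rule rel, rule leavitt_relations.p_s leavitt_relations.s_star_p, fact Aa, fact Aa)+
  next
    fix a assume a: "a \<in> alphabet"
    show "ideal.congr (s_star_elem a * s_elem a) (p_elem (rel_range E lab (verts E) [a]))"
      "ideal.congr (s_elem a * s_star_elem a * s_elem a) (s_elem a)"
      "ideal.congr (s_star_elem a * s_elem a * s_star_elem a) (s_star_elem a)"
      unfolding congr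
      by (rule rel, rule leavitt_relations.s_star_s leavitt_relations.s_s_star_s
          leavitt_relations.s_star_s_s_star, fact a)+
  next
    fix a b assume "a \<in> alphabet" "b \<in> alphabet" "b \<noteq> a"
    then show "ideal.congr (s_star_elem b * s_elem a) 0"
      unfolding congr using rel[OF leavitt_relations.s_star_s_neq, of a b] by simp
  next
    fix c :: 'k and x :: "('v, 'l) generator list \<Rightarrow>\<^sub>0 'k"
    show "Poly_Mapping.single 0 c * x = x * Poly_Mapping.single 0 c"
      by (rule single_zero_central[symmetric])
  qed (simp_all add: single_add mult_single)
  have word: "family.homogeneous_element (word_degree generator_degree w) (Poly_Mapping.single w 1)"
    if "w \<noteq> []" "w \<in> lists ?X" for w
    using that
  proof (induction w rule: list_nonempty_induct)
    case (single g)
    then show ?case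
      by (cases g) (auto simp: word_degree_def mem_leavitt_generators
          family.homogeneous_element_p family.homogeneous_element_s family.homogeneous_element_t)
  next
    case (cons g w)
    have *: "Poly_Mapping.single (g # w) 1 = Poly_Mapping.single [g] (1::'k) * Poly_Mapping.single w 1"
      by (simp add: mult_single plus_list_def)
    from cons show ?case unfolding *
      by (cases g) (auto simp: word_degree_def mem_leavitt_generators
          family.homogeneous_element_p family.homogeneous_element_s family.homogeneous_element_t)
  qed
  have "semiprimitive (presented_algebra ?X ?Rel)"
  proof (rule L.semiprimitive_presented_algebra)
    fix n x assume x: "x \<in> carrier L.F" "homogeneous generator_degree n x"
    have "x = (\<Sum>w\<in>Poly_Mapping.keys x. Poly_Mapping.single 0 (Poly_Mapping.lookup x w) * Poly_Mapping.single w 1)"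
    proof (rule poly_mapping_eqI)
      fix v
      show "Poly_Mapping.lookup x v = Poly_Mapping.lookup (\<Sum>w\<in>Poly_Mapping.keys x.
          Poly_Mapping.single 0 (Poly_Mapping.lookup x w) * Poly_Mapping.single w 1) v"
        by (simp add: mult_single lookup_sum lookup_single when_def in_keys_iff)
    qed
    also have "family.homogeneous_element n \<dots>"
    proof (intro family.homogeneous_element_sum family.homogeneous_element_scale)
      fix w assume "w \<in> Poly_Mapping.keys x"
      then have "w \<in> lists ?X" "w \<noteq> []" "word_degree generator_degree w = n"
        using x by (auto simp: carrier_free_algebra homogeneous_def)
      then show "family.homogeneous_element n (Poly_Mapping.single w 1)" using word by metis
    qed
    finally obtain y where "ideal.congr (x * y * x) x"
      using family.homogeneous_element_regular by blast
    then show "\<exists>y. x - x * y * x \<in> L.H_ext"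
      using ideal.congr_sym by (auto simp: congr)
  qed
  then show ?thesis by (simp add: leavitt_labelled_path_algebra_def)
qed

end

theorem theorem4p5:
  fixes E :: "('v, 'e) pre_digraph" and lab :: "'e \<Rightarrow> 'l" and alphabet :: "'l set"
    and \<B> :: "'v set set"
  assumes "normal_labelled_space E lab alphabet \<B>"
  shows "semiprimitive (leavitt_labelled_path_algebra TYPE('k::field) E lab alphabet \<B>)"
  using assms by (rule normal_labelled_space.semiprimitive_leavitt)

end
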